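(* Let $\mathbb{Y}$ be a $\boldsymbol{\psi}$-GrOU process, i.e. a solution of $d\mathbb{Y}_t=-\mathbf{Q}(\boldsymbol{\psi})\mathbb{Y}_{t-}dt+d\mathbb{L}_t$, $t\ge0$, with $\mathbf{Q}(\boldsymbol{\psi})=(\mathbf{I}_{d\times d}+\overline{\mathbf{A}})\odot\mathrm{vec}^{-1}(\boldsymbol{\psi})$, where the adjacency matrix $\mathbf{A}$ is deterministic, static in time and known, all eigenvalues of $\mathbf{Q}(\boldsymbol{\psi})$ have positive real part, and the Lévy measure $\nu$ of $\mathbb{L}$ satisfies $\int_{\|\boldsymbol{z}\|>1}\ln\|\boldsymbol{z}\|\,\nu(d\boldsymbol{z})<\infty$. Assume that $\mathbb{Y}$ is observed in continuous time and has finite second moments. Let $\widehat{\boldsymbol{\Psi}}$ be a compact set with $$\widehat{\boldsymbol{\Psi}}\subseteq\Big\{\boldsymbol{\psi}\in\mathbb{R}^{d^2}:\psi_{d(i-1)+i}>n_i\sum_{j\ne i}|\psi_{d(j-1)+i}|>0,\ \forall i\in\{1,\dots,d\}\Big\}.$$ Then the maximum likelihood estimator (MLE) $\widehat{\boldsymbol{\psi}}_t$ on $\widehat{\boldsymbol{\Psi}}$ solves $$\mathbb{I}_t=[\mathbb{I}]_t\cdot\widehat{\boldsymbol{\psi}}_t,\qquad t\ge0.$$ Moreover: 1. $\det([\mathbb{I}]_t)>0$ $P_{t,\mathbb{Y}}$-a.s. for $t\ge0$ large enough, and $\widehat{\boldsymbol{\psi}}_t=[\mathbb{I}]_t^{-1}\cdot\mathbb{I}_t$.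 2. The MLE $\widehat{\boldsymbol{\psi}}_t$ exists almost surely and uniquely under $P_{t,\mathbb{Y}}$.
   Context: Graph: $\mathbf{A}=(a_{ij})\in\{0,1\}^{d\times d}$ with $a_{ii}=0$; $n_i:=1\vee\sum_{j\ne i}a_{ij}$; $\overline{\mathbf{A}}:=\mathrm{diag}(n_1^{-1},\dots,n_d^{-1})\mathbf{A}$. $\odot$ is the Hadamard product, $\otimes$ the Kronecker product, $\mathrm{vec}$ stacks columns, and $\mathrm{vec}^{-1}(\boldsymbol{\psi})$ is the $d\times d$ matrix with $(i,j)$ entry $\psi_{d(j-1)+i}$. Noise and process: $\mathbb{L}=(\mathbb{L}_t)_{t\in\mathbb{R}}$ is a two-sided càdlàg $d$-dimensional Lévy process with characteristic triplet $(\boldsymbol{b},\boldsymbol{\Sigma},\nu)$ (truncation function $\mathbb{I}_{\{\|z\|\le1\}}$), $\boldsymbol{\Sigma}$ symmetric positive definite; $\mathbb{Y}_0$ is independent of $(\mathbb{L}_t)_{t\ge0}$. Under the eigenvalue and log-moment conditions the SDE has a unique strictly stationary solution, and it is this stationary process that is considered. Likelihood: $\langle x,y\rangle_{\boldsymbol{\Sigma}}:=x^\top\boldsymbol{\Sigma}^{-1}y$. $P_0$ is the reference measure, $\mathbb{Y}^c$ the continuous $P_0$-martingale part of $\mathbb{Y}$; $P_{t,0},P_{t,\mathbb{Y}}$ are the restrictions to $\mathcal{F}_t$ of $P_0$ and of $P_{\mathbb{Y}}$, the measure under which $\mathbb{Y}$ satisfies the OU equation with matrix $\mathbf{Q}$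 (then $d\mathbb{Y}^c_t=-\mathbf{Q}\mathbb{Y}_tdt+d\mathbb{W}_t$, $\mathbb{W}$ the Gaussian part of $\mathbb{L}$), with $$\frac{dP_{t,\mathbb{Y}}}{dP_{t,0}}=\exp\Big\{-\int_0^t\langle \mathbf{Q}\mathbb{Y}_s,d\mathbb{Y}^c_s\rangle_{\boldsymbol{\Sigma}}-\tfrac12\int_0^t\langle\mathbf{Q}\mathbb{Y}_s,\mathbf{Q}\mathbb{Y}_s\rangle_{\boldsymbol{\Sigma}}ds\Big\}.$$ The likelihood in $\boldsymbol{\psi}$ is written for the unrestricted dynamics matrix $\mathbf{Q}=\mathrm{vec}^{-1}(\boldsymbol{\psi})$ (the network topology is applied afterwards through the linear map $\boldsymbol{\psi}\mapsto\mathrm{vec}(\mathbf{I}_{d\times d}+\overline{\mathbf{A}})\odot\boldsymbol{\psi}$): $\mathcal{L}_t(\boldsymbol{\psi};\mathbb{Y})=\exp(\boldsymbol{\psi}^\top\mathbb{I}_t-\tfrac12\boldsymbol{\psi}^\top[\mathbb{I}]_t\boldsymbol{\psi})$, where $\mathbb{I}_t:=-\int_0^t\mathbb{Y}_s\otimes\boldsymbol{\Sigma}^{-1}d\mathbb{Y}^c_s$, $\mathbf{K}_t:=\int_0^t\mathbb{Y}_s\mathbb{Y}_s^\top ds$ and $[\mathbb{I}]_t:=\mathbf{K}_t\otimes\boldsymbol{\Sigma}^{-1}$. The MLE is the maximiser of $\boldsymbol{\psi}\mapsto\mathcal{L}_t(\boldsymbol{\psi};\mathbb{Y})$.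
   Formalization: The MLE is the maximiser over all parameters. For the maximiser on the compact set, the equation and formula are stated if it is interior, existence and uniqueness if the MLE lies in the set (a boundary maximiser may not solve the equation). Item 2 is for t > 0, as uniqueness fails at t = 0. *)

theory Defs
  imports "HOL-Probability.Probability"
begin

section \<open>Matrices and graphs\<close>

definition hadamard :: "real^'m^'n \<Rightarrow> real^'m^'n \<Rightarrow> real^'m^'n" where
  "hadamard B C = (\<chi> i j. B $ i $ j * C $ i $ j)"

text \<open>Vectors of length \<open>d\<^sup>2\<close> are indexed by pairs. The pair \<open>(j, i)\<close> stands for the
  position \<open>d (j - 1) + i\<close>, so the first component selects the column (block) and the second
  the row within it.\<close>

definition vec_inv :: "real^('n::finite \<times> 'n) \<Rightarrow> real^'n^'n" where
  "vec_inv \<psi> = (\<chi> i j. \<psi> $ (j, i))"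

definition kron :: "real^'n^'n \<Rightarrow> real^'n^'n \<Rightarrow> real^('n::finite \<times> 'n)^('n::finite \<times> 'n)" where
  "kron B C = (\<chi> p q. B $ fst p $ fst q * C $ snd p $ snd q)"

definition kron_vec :: "real^'n \<Rightarrow> real^'n \<Rightarrow> real^('n::finite \<times> 'n)" where
  "kron_vec x y = (\<chi> p. x $ fst p * y $ snd p)"

definition sym_pos_def :: "real^'n^'n \<Rightarrow> bool" where
  "sym_pos_def S \<longleftrightarrow> transpose S = S \<and> (\<forall>x. x \<noteq> 0 \<longrightarrow> x \<bullet> (S *v x) > 0)"

definition complex_eigenvalue :: "real^'n^'n \<Rightarrow> complex \<Rightarrow> bool" where
  "complex_eigenvalue Q z \<longleftrightarrow>
     (\<exists>v :: complex^'n. v \<noteq> 0 \<and> (\<chi> i j. complex_of_real (Q $ i $ j)) *v v = z *s v)"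

definition adjacency_matrix :: "real^'n^'n \<Rightarrow> bool" where
  "adjacency_matrix A \<longleftrightarrow> (\<forall>i j. A $ i $ j \<in> {0, 1}) \<and> (\<forall>i. A $ i $ i = 0)"

definition degree_or_1 :: "real^'n^'n \<Rightarrow> 'n \<Rightarrow> real" where
  "degree_or_1 A i = max 1 (\<Sum>j\<in>UNIV - {i}. A $ i $ j)"

definition row_normalised :: "real^'n^'n \<Rightarrow> real^'n^'n" where
  "row_normalised A = (\<chi> i j. A $ i $ j / degree_or_1 A i)"

definition grou_matrix :: "real^'n^'n \<Rightarrow> real^('n::finite \<times> 'n) \<Rightarrow> real^'n^'n" where
  "grou_matrix A \<psi> = hadamard (mat 1 + row_normalised A) (vec_inv \<psi>)"

definition dominant_params :: "real^'n^'n \<Rightarrow> (real^('n::finite \<times> 'n)) set" where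
  "dominant_params A =
     {\<psi>. \<forall>i. \<psi> $ (i, i) > degree_or_1 A i * (\<Sum>j\<in>UNIV - {i}. \<bar>\<psi> $ (j, i)\<bar>) \<and>
              degree_or_1 A i * (\<Sum>j\<in>UNIV - {i}. \<bar>\<psi> $ (j, i)\<bar>) > 0}"

section \<open>Levy noise and the Ornstein-Uhlenbeck equation\<close>

definition cadlag_on :: "real set \<Rightarrow> (real \<Rightarrow> 'b::topological_space) \<Rightarrow> bool" where
  "cadlag_on T f \<longleftrightarrow>
     (\<forall>t\<in>T. (f \<longlongrightarrow> f t) (at t within T \<inter> {t<..}) \<and> (\<exists>l. (f \<longlongrightarrow> l) (at t within T \<inter> {..<t})))"

definition levy_measure :: "(real^'n) measure \<Rightarrow> bool" where
  "levy_measure \<nu> \<longleftrightarrow> sets \<nu> = sets borel \<and> emeasure \<nu> {0} = 0 \<and>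
     (\<integral>\<^sup>+ z. ennreal (min 1 ((norm z)\<^sup>2)) \<partial>\<nu>) < \<infinity>"

definition levy_exponent ::
  "real^'n \<Rightarrow> real^'n^'n \<Rightarrow> (real^'n) measure \<Rightarrow> real^'n \<Rightarrow> complex" where
  "levy_exponent b \<Sigma> \<nu> u =
     \<i> * complex_of_real (u \<bullet> b) - complex_of_real (u \<bullet> (\<Sigma> *v u)) / 2
     + (LINT z|\<nu>. iexp (u \<bullet> z) - 1 - (if norm z \<le> 1 then \<i> * complex_of_real (u \<bullet> z) else 0))"

text \<open>A two-sided Levy process with characteristic triplet \<open>(b, \<Sigma>, \<nu>)\<close>.\<close>

definition levy_process ::
  "'a measure \<Rightarrow> (real \<Rightarrow> 'a \<Rightarrow> real^'n) \<Rightarrow> real^'n \<Rightarrow> real^'n^'n \<Rightarrow> (real^'n) measure \<Rightarrow> bool" where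
  "levy_process P L b \<Sigma> \<nu> \<longleftrightarrow>
     levy_measure \<nu> \<and>
     (\<forall>t. L t \<in> borel_measurable P) \<and>
     (\<forall>\<omega>\<in>space P. cadlag_on UNIV (\<lambda>t. L t \<omega>)) \<and>
     (AE \<omega> in P. L 0 \<omega> = 0) \<and>
     (\<forall>(n::nat) \<tau> :: nat \<Rightarrow> real. (\<forall>k<n. \<tau> k \<le> \<tau> (Suc k)) \<longrightarrow>
        prob_space.indep_vars P (\<lambda>_. borel) (\<lambda>k \<omega>. L (\<tau> (Suc k)) \<omega> - L (\<tau> k) \<omega>) {..<n}) \<and>
     (\<forall>s t. s \<le> t \<longrightarrow>
        distr P borel (\<lambda>\<omega>. L t \<omega> - L s \<omega>) = distr P borel (L (t - s))) \<and>
     (\<forall>t\<ge>0. \<forall>u. (LINT \<omega>|P. iexp (u \<bullet> L t \<omega>)) = exp (complex_of_real t * levy_exponent b \<Sigma> \<nu> u))"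

definition solves_ou ::
  "'a measure \<Rightarrow> (real \<Rightarrow> 'a \<Rightarrow> real^'n) \<Rightarrow> real^'n^'n \<Rightarrow> (real \<Rightarrow> 'a \<Rightarrow> real^'n) \<Rightarrow> bool" where
  "solves_ou P L Q Y \<longleftrightarrow>
     (AE \<omega> in P. \<forall>t\<ge>0.
        Y t \<omega> = Y 0 \<omega> - (LINT s:{0..t}|lborel. Q *v Lim (at_left s) (\<lambda>r. Y r \<omega>)) + (L t \<omega> - L 0 \<omega>))"

definition strictly_stationary ::
  "'a measure \<Rightarrow> (real \<Rightarrow> 'a \<Rightarrow> 'b::topological_space) \<Rightarrow> bool" where
  "strictly_stationary P Y \<longleftrightarrow>
     (\<forall>(n::nat) (\<tau> :: nat \<Rightarrow> real) h. (\<forall>k<n. 0 \<le> \<tau> k) \<longrightarrow> 0 \<le> h \<longrightarrow>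
        distr P (Pi\<^sub>M {..<n} (\<lambda>_. borel)) (\<lambda>\<omega>. \<lambda>k\<in>{..<n}. Y (\<tau> k + h) \<omega>) =
        distr P (Pi\<^sub>M {..<n} (\<lambda>_. borel)) (\<lambda>\<omega>. \<lambda>k\<in>{..<n}. Y (\<tau> k) \<omega>))"

section \<open>Continuous martingale parts\<close>

text \<open>Processes and filtrations are carried by the time axis \<open>real\<close>, but in this section and the
  next only times \<open>t \<ge> 0\<close> are relevant.\<close>

definition adapted :: "(real \<Rightarrow> 'a measure) \<Rightarrow> (real \<Rightarrow> 'a \<Rightarrow> 'b::topological_space) \<Rightarrow> bool" where
  "adapted F X \<longleftrightarrow> (\<forall>t\<ge>0. X t \<in> borel_measurable (F t))"

definition null_at_0 :: "'a measure \<Rightarrow> (real \<Rightarrow> 'a \<Rightarrow> real) \<Rightarrow> bool" where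
  "null_at_0 P X \<longleftrightarrow> (\<forall>\<omega>\<in>space P. X 0 \<omega> = 0)"

definition usual_augmentation :: "'a measure \<Rightarrow> (real \<Rightarrow> 'a measure) \<Rightarrow> real \<Rightarrow> 'a measure" where
  "usual_augmentation P F t =
     sigma (space P) (\<Inter>u\<in>{t<..}. sigma_sets (space P) (sets (F u) \<union> null_sets P))"

definition is_martingale :: "'a measure \<Rightarrow> (real \<Rightarrow> 'a measure) \<Rightarrow> (real \<Rightarrow> 'a \<Rightarrow> real) \<Rightarrow> bool" where
  "is_martingale P F X \<longleftrightarrow>
     adapted F X \<and> (\<forall>t\<ge>0. integrable P (X t)) \<and>
     (\<forall>s t. 0 \<le> s \<longrightarrow> s \<le> t \<longrightarrow> (AE \<omega> in P. real_cond_exp P (F s) (X t) \<omega> = X s \<omega>))"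

text \<open>Localising sequences may be taken finite-valued: replace \<open>T n\<close> by \<open>min (T n) n\<close>.\<close>

definition local_martingale ::
  "'a measure \<Rightarrow> (real \<Rightarrow> 'a measure) \<Rightarrow> (real \<Rightarrow> 'a \<Rightarrow> real) \<Rightarrow> bool" where
  "local_martingale P F X \<longleftrightarrow>
     adapted F X \<and> (\<forall>\<omega>\<in>space P. cadlag_on {0..} (\<lambda>t. X t \<omega>)) \<and>
     (\<exists>T :: nat \<Rightarrow> 'a \<Rightarrow> real.
        (\<forall>n. stopping_time F (T n) \<and> (\<forall>\<omega>\<in>space P. 0 \<le> T n \<omega>)) \<and>
        (AE \<omega> in P. incseq (\<lambda>n. T n \<omega>) \<and> filterlim (\<lambda>n. T n \<omega>) at_top sequentially) \<and>
        (\<forall>n. is_martingale P F (\<lambda>t \<omega>. X (min t (T n \<omega>)) \<omega>)))"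

definition continuous_local_martingale ::
  "'a measure \<Rightarrow> (real \<Rightarrow> 'a measure) \<Rightarrow> (real \<Rightarrow> 'a \<Rightarrow> real) \<Rightarrow> bool" where
  "continuous_local_martingale P F X \<longleftrightarrow>
     local_martingale P F X \<and> (\<forall>\<omega>\<in>space P. continuous_on {0..} (\<lambda>t. X t \<omega>))"

definition purely_discontinuous ::
  "'a measure \<Rightarrow> (real \<Rightarrow> 'a measure) \<Rightarrow> (real \<Rightarrow> 'a \<Rightarrow> real) \<Rightarrow> bool" where
  "purely_discontinuous P F D \<longleftrightarrow>
     local_martingale P F D \<and> null_at_0 P D \<and>
     (\<forall>N. continuous_local_martingale P F N \<longrightarrow> local_martingale P F (\<lambda>t \<omega>. D t \<omega> * N t \<omega>))"

definition increasing_process ::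
  "'a measure \<Rightarrow> (real \<Rightarrow> 'a measure) \<Rightarrow> (real \<Rightarrow> 'a \<Rightarrow> real) \<Rightarrow> bool" where
  "increasing_process P F B \<longleftrightarrow>
     adapted F B \<and> null_at_0 P B \<and>
     (\<forall>\<omega>\<in>space P. cadlag_on {0..} (\<lambda>t. B t \<omega>) \<and> mono_on {0..} (\<lambda>t. B t \<omega>))"

text \<open>\<open>Xc\<close> is the continuous (local) martingale part in the semimartingale decomposition
  \<open>X = X\<^sub>0 + Xc + D + (B - C)\<close>, with \<open>D\<close> a purely discontinuous local martingale and
  \<open>B - C\<close> a process of finite variation.\<close>

definition continuous_martingale_part ::
  "'a measure \<Rightarrow> (real \<Rightarrow> 'a measure) \<Rightarrow> (real \<Rightarrow> 'a \<Rightarrow> real) \<Rightarrow> (real \<Rightarrow> 'a \<Rightarrow> real) \<Rightarrow> bool" where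
  "continuous_martingale_part P F X Xc \<longleftrightarrow>
     continuous_local_martingale P F Xc \<and> null_at_0 P Xc \<and>
     (\<exists>D B C. purely_discontinuous P F D \<and> increasing_process P F B \<and> increasing_process P F C \<and>
        (AE \<omega> in P. \<forall>t\<ge>0. X t \<omega> = X 0 \<omega> + Xc t \<omega> + D t \<omega> + (B t \<omega> - C t \<omega>)))"

section \<open>Stochastic integrals and the likelihood\<close>

text \<open>For a cadlag adapted integrand \<open>H\<close> and a continuous integrator \<open>X\<close>, the Ito integral
  \<open>\<integral>\<^sub>0\<^sup>t bil (H\<^sub>s) (dX\<^sub>s)\<close>, with \<open>bil\<close> bilinear, is the limit in probability of the
  left-point Riemann sums as the mesh of the partition of \<open>{0..t}\<close> tends to zero. The version
  \<open>I\<close> is required to be measurable with respect to \<open>G\<close> (the \<open>\<sigma>\<close>-algebra at time \<open>t\<close>).\<close>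

definition has_ito_integral ::
  "'a measure \<Rightarrow> 'a measure \<Rightarrow> ('b \<Rightarrow> 'c \<Rightarrow> 'e::euclidean_space) \<Rightarrow>
   (real \<Rightarrow> 'a \<Rightarrow> 'b) \<Rightarrow> (real \<Rightarrow> 'a \<Rightarrow> 'c::ab_group_add) \<Rightarrow> real \<Rightarrow> ('a \<Rightarrow> 'e) \<Rightarrow> bool" where
  "has_ito_integral P G bil H X t I \<longleftrightarrow>
     I \<in> borel_measurable G \<and>
     (\<forall>e>0. \<exists>\<delta>>0. \<forall>(n::nat) \<tau> :: nat \<Rightarrow> real.
        \<tau> 0 = 0 \<longrightarrow> \<tau> n = t \<longrightarrow> (\<forall>k<n. \<tau> k \<le> \<tau> (Suc k) \<and> \<tau> (Suc k) - \<tau> k < \<delta>) \<longrightarrow>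
        measure P {\<omega> \<in> space P.
          norm ((\<Sum>k<n. bil (H (\<tau> k) \<omega>) (X (\<tau> (Suc k)) \<omega> - X (\<tau> k) \<omega>)) - I \<omega>) > e} < e)"

definition inner_cov :: "real^'n^'n \<Rightarrow> real^'n \<Rightarrow> real^'n \<Rightarrow> real" where
  "inner_cov \<Sigma> x y = x \<bullet> (matrix_inv \<Sigma> *v y)"

text \<open>The restriction of \<open>P\<close> to \<open>F t\<close> has density
  \<open>exp (- \<integral>\<langle>Q Y, dYc\<rangle> - 1/2 \<integral>\<langle>Q Y, Q Y\<rangle> ds)\<close> with respect to the restriction of \<open>P0\<close>.\<close>

definition ou_density_at ::
  "'a measure \<Rightarrow> 'a measure \<Rightarrow> (real \<Rightarrow> 'a measure) \<Rightarrow> real^'n^'n \<Rightarrow> real^'n^'n \<Rightarrow>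
   (real \<Rightarrow> 'a \<Rightarrow> real^'n) \<Rightarrow> (real \<Rightarrow> 'a \<Rightarrow> real^'n) \<Rightarrow> real \<Rightarrow> bool" where
  "ou_density_at P P0 F \<Sigma> Q Y Yc t \<longleftrightarrow>
     (\<exists>J. has_ito_integral P0 (F t) (\<lambda>y x. inner_cov \<Sigma> (Q *v y) x) Y Yc t J \<and>
        restr_to_subalg P (F t) =
        density (restr_to_subalg P0 (F t))
          (\<lambda>\<omega>. ennreal (exp (- J \<omega>
             - 1/2 * (LINT s:{0..t}|lborel. inner_cov \<Sigma> (Q *v Y s \<omega>) (Q *v Y s \<omega>))))))"

definition K_mat :: "(real \<Rightarrow> 'a \<Rightarrow> real^'n) \<Rightarrow> real \<Rightarrow> 'a \<Rightarrow> real^'n^'n" where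
  "K_mat Y t \<omega> = (\<chi> i j. LINT s:{0..t}|lborel. Y s \<omega> $ i * Y s \<omega> $ j)"

definition I_bracket ::
  "real^'n^'n \<Rightarrow> (real \<Rightarrow> 'a \<Rightarrow> real^'n) \<Rightarrow> real \<Rightarrow> 'a \<Rightarrow> real^('n::finite \<times> 'n)^('n::finite \<times> 'n)" where
  "I_bracket \<Sigma> Y t \<omega> = kron (K_mat Y t \<omega>) (matrix_inv \<Sigma>)"

text \<open>\<open>I = - \<integral>\<^sub>0\<^sup>t Y\<^sub>s \<otimes> \<Sigma>\<^sup>-\<^sup>1 dYc\<^sub>s\<close>.\<close>

definition is_score_integral ::
  "'a measure \<Rightarrow> (real \<Rightarrow> 'a measure) \<Rightarrow> real^'n^'n \<Rightarrow>
   (real \<Rightarrow> 'a \<Rightarrow> real^'n) \<Rightarrow> (real \<Rightarrow> 'a \<Rightarrow> real^'n) \<Rightarrow> real \<Rightarrow> ('a \<Rightarrow> real^('n::finite \<times> 'n)) \<Rightarrow> bool" where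
  "is_score_integral P0 F \<Sigma> Y Yc t I \<longleftrightarrow>
     has_ito_integral P0 (F t) (\<lambda>y x. kron_vec y (matrix_inv \<Sigma> *v x)) Y Yc t (\<lambda>\<omega>. - I \<omega>)"

definition likelihood ::
  "real^('n::finite \<times> 'n) \<Rightarrow> real^('n::finite \<times> 'n)^('n::finite \<times> 'n) \<Rightarrow> real^('n::finite \<times> 'n) \<Rightarrow> real" where
  "likelihood I B \<psi> = exp (\<psi> \<bullet> I - 1/2 * (\<psi> \<bullet> (B *v \<psi>)))"

definition is_mle_on ::
  "(real^('n::finite \<times> 'n)) set \<Rightarrow> real^('n::finite \<times> 'n) \<Rightarrow> real^('n::finite \<times> 'n)^('n::finite \<times> 'n) \<Rightarrow> real^('n::finite \<times> 'n) \<Rightarrow> bool" where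
  "is_mle_on S I B \<phi> \<longleftrightarrow> \<phi> \<in> S \<and> (\<forall>\<psi>\<in>S. likelihood I B \<psi> \<le> likelihood I B \<phi>)"

abbreviation is_mle ::
  "real^('n::finite \<times> 'n) \<Rightarrow> real^('n::finite \<times> 'n)^('n::finite \<times> 'n) \<Rightarrow> real^('n::finite \<times> 'n) \<Rightarrow> bool" where
  "is_mle \<equiv> is_mle_on UNIV"

end

theory Submission
  imports Defs
begin

text \<open>
  The log-likelihood is the quadratic function \<open>\<psi> \<mapsto> \<psi> \<bullet> J - 1/2 (\<psi> \<bullet> (B *v \<psi>))\<close> with \<open>J\<close> the score
  integral and \<open>B\<close> the information matrix \<open>K\<^sub>t \<otimes> \<Sigma>\<^sup>-\<^sup>1\<close>. At a maximiser in the interior of the parameter set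
  the gradient \<open>J - B *v \<psi>\<close> vanishes (\<open>interior_mle_solves_score_equation\<close>), which is the equation
  for the estimator on every path. If \<open>B\<close> is positive definite, the function is strictly concave and
  \<open>B\<^sup>-\<^sup>1 J\<close> is its only maximiser (\<open>mle_iff_of_sym_pos_def\<close>). All the probability lies in showing
  that \<open>B\<close> is almost surely positive definite, at every time \<open>t > 0\<close>.

  The quadratic form of \<open>B\<close> at \<open>v\<close> is the time integral of \<open>\<langle>V Y\<^sub>s, V Y\<^sub>s\<rangle>\<close>, where \<open>V\<close> is \<open>v\<close> rearranged
  as a matrix and the inner product is that of \<open>\<Sigma>\<^sup>-\<^sup>1\<close> (\<open>I_bracket_quadratic_form\<close>). If it vanishes for
  some \<open>v \<noteq> 0\<close>, then by right-continuity \<open>V Y\<^sub>s = 0\<close> for all \<open>s < t\<close>, so the path stays in a hyperplane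
  \<open>{y. x \<bullet> y = 0}\<close> whose normal vector \<open>x\<close> may depend on the path
  (\<open>I_bracket_degenerate_imp_hyperplane\<close>). The Ornstein-Uhlenbeck equation then writes \<open>x \<bullet> L\<^sub>s\<close> as
  a constant plus the integral of a bounded function, so \<open>x \<bullet> L\<close> is Lipschitz on \<open>[0, t/2]\<close>.

  This contradicts the non-degenerate Gaussian part of the noise. In a fixed direction \<open>y\<close>, the law of
  \<open>y \<bullet> L\<^sub>h / sqrt h\<close> converges to a centred normal law of variance \<open>y \<bullet> (\<Sigma> *v y)\<close> as \<open>h\<close> tends to zero, because
  drift and jumps disappear under this scaling. A Lipschitz path has increments of order \<open>h\<close>,
  much smaller than \<open>sqrt h\<close>, and by independence the probability that \<open>n\<close> consecutive increments over
  steps of length \<open>h = T/n\<close> are all this small decays geometrically in \<open>n\<close>. The random direction \<open>x\<close> is handled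
  by covering the unit sphere with finitely many balls on which the same estimate holds
  (\<open>levy_not_lipschitz_in_any_direction\<close>).
\<close>

section \<open>Quadratic log-likelihoods\<close>

lemma symmetric_inner_swap:
  fixes B :: "real^'m^'m"
  assumes "transpose B = B"
  shows "x \<bullet> (B *v y) = y \<bullet> (B *v x)"
  by (metis assms dot_lmul_matrix inner_commute transpose_matrix_vector)

lemma quadratic_form_along_line:
  fixes B :: "real^'m^'m"
  assumes "transpose B = B"
  shows "(x + e *\<^sub>R u) \<bullet> (B *v (x + e *\<^sub>R u)) =
    x \<bullet> (B *v x) + 2 * e * (u \<bullet> (B *v x)) + e\<^sup>2 * (u \<bullet> (B *v u))"
  using symmetric_inner_swap[OF assms, of x u]
  by (simp add: matrix_vector_right_distrib scaleR_matrix_vector_assoc[symmetric]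
      matrix_vector_mult_scaleR inner_add_left inner_add_right power2_eq_square algebra_simps)

text \<open>A step of size \<open>e\<close> in the direction \<open>u = J - B *v \<phi>\<close> of the gradient changes the log-likelihood by
  \<open>e (u \<bullet> u)\<close> up to a term quadratic in \<open>e\<close>. At a maximum this change is at most zero for all small
  \<open>e\<close>, which forces \<open>u = 0\<close>.\<close>

lemma interior_mle_solves_score_equation:
  assumes sym: "transpose B = B" and mle: "is_mle_on S J B \<phi>" and int: "\<phi> \<in> interior S"
  shows "J = B *v \<phi>"
proof -
  define u where "u = J - B *v \<phi>"
  obtain r where r: "r > 0" "cball \<phi> r \<subseteq> S"
    using int mem_interior_cball by blast
  have "u \<bullet> u \<le> e * (\<bar>u \<bullet> (B *v u)\<bar>)" if e: "0 < e" "e \<le> r / (norm u + 1)" for e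
  proof -
    have "e * norm u \<le> r / (norm u + 1) * norm u"
      using e by (intro mult_right_mono) auto
    also have "\<dots> \<le> r"
      using r by (simp add: field_simps add_pos_nonneg)
    finally have "\<phi> + e *\<^sub>R u \<in> S"
      using r e by (auto intro!: subsetD[OF r(2)] simp: dist_norm)
    then have "likelihood J B (\<phi> + e *\<^sub>R u) \<le> likelihood J B \<phi>"
      using mle by (simp add: is_mle_on_def)
    then have "e * (u \<bullet> J) - e * (u \<bullet> (B *v \<phi>)) - e\<^sup>2 / 2 * (u \<bullet> (B *v u)) \<le> 0"
      unfolding likelihood_def quadratic_form_along_line[OF sym]
      by (simp add: inner_add_left algebra_simps)
    then have "e * (u \<bullet> u - e / 2 * (u \<bullet> (B *v u))) \<le> 0"
      by (simp add: u_def inner_diff_right algebra_simps power2_eq_square)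
    then have "u \<bullet> u \<le> e / 2 * (u \<bullet> (B *v u))"
      using e by (simp add: mult_le_0_iff)
    also have "\<dots> \<le> e / 2 * \<bar>u \<bullet> (B *v u)\<bar>"
      using e by (intro mult_left_mono) auto
    also have "\<dots> \<le> e * \<bar>u \<bullet> (B *v u)\<bar>"
      using e by (intro mult_right_mono) auto
    finally show ?thesis .
  qed
  then have "\<forall>\<^sub>F e in at_right 0. u \<bullet> u \<le> e * (\<bar>u \<bullet> (B *v u)\<bar>)"
    using r by (auto simp: eventually_at_right_field intro!: exI[of _ "r / (norm u + 1)"]
        divide_pos_pos add_nonneg_pos)
  moreover have "((\<lambda>e. e * \<bar>u \<bullet> (B *v u)\<bar>) \<longlongrightarrow> 0 * \<bar>u \<bullet> (B *v u)\<bar>) (at_right 0)"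
    by (intro tendsto_intros)
  ultimately have "u \<bullet> u \<le> 0 * \<bar>u \<bullet> (B *v u)\<bar>"
    by (intro tendsto_lowerbound) auto
  then have "u = 0" by (metis inner_gt_zero_iff mult_zero_left not_le)
  then show ?thesis by (simp add: u_def)
qed

lemma matrix_inv_mult:
  assumes "invertible B"
  shows "B ** matrix_inv B = mat 1" "matrix_inv B ** B = mat 1"
  using assms unfolding invertible_def matrix_inv_def by (metis (mono_tags, lifting) someI_ex)+

lemma pos_def_imp_invertible:
  fixes B :: "real^'m^'m"
  assumes "\<And>x. x \<noteq> 0 \<Longrightarrow> x \<bullet> (B *v x) > 0"
  shows "invertible B"
proof -
  have "x = 0" if "B *v x = 0" for x
    using assms[of x] that by force
  then show ?thesis
    by (metis matrix_left_invertible_ker invertible_left_inverse)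
qed

text \<open>Every matrix on the segment from the identity to \<open>B\<close> is positive definite and hence invertible.
  The determinant is continuous and has no zero along the segment, so it keeps the sign it has at the
  identity.\<close>

lemma pos_def_imp_det_pos:
  fixes B :: "real^'m^'m"
  assumes pos: "\<And>x. x \<noteq> 0 \<Longrightarrow> x \<bullet> (B *v x) > 0"
  shows "det B > 0"
proof (rule ccontr)
  let ?C = "\<lambda>s. mat (1 - s) + s *\<^sub>R B"
  assume "\<not> det B > 0"
  moreover have "continuous_on {0..1} (\<lambda>s. det (?C s))"
  proof -
    have "continuous_on {0..1} (\<lambda>s. ?C s $ i $ j)" for i j
      by (cases "i = j") (auto simp: mat_def intro!: continuous_intros)
    then show ?thesis
      unfolding det_def by (intro continuous_on_sum continuous_on_mult continuous_on_prod continuous_on_const)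
  qed
  ultimately obtain s where s: "0 \<le> s" "s \<le> 1" "det (?C s) = 0"
    using IVT2'[of "\<lambda>s. det (?C s)" 1 0 0] by auto
  have "x \<bullet> (?C s *v x) > 0" if "x \<noteq> 0" for x
  proof -
    have "mat (1 - s) *v x = (1 - s) *\<^sub>R x"
      by (simp add: vec_eq_iff matrix_vector_mult_def mat_def if_distrib if_distribR cong: if_cong)
    then have "x \<bullet> (?C s *v x) = (1 - s) * (x \<bullet> x) + s * (x \<bullet> (B *v x))"
      by (simp add: matrix_vector_mult_add_rdistrib scaleR_matrix_vector_assoc[symmetric] inner_add_right)
    moreover have "(1 - s) * (x \<bullet> x) \<ge> 0" "s * (x \<bullet> (B *v x)) \<ge> 0"
      using s pos[OF that] by auto
    moreover have "(1 - s) * (x \<bullet> x) > 0 \<or> s * (x \<bullet> (B *v x)) > 0"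
      using s pos[OF that] that by (cases "s = 1") auto
    ultimately show ?thesis by linarith
  qed
  then show False
    using s(3) pos_def_imp_invertible invertible_det_nz by blast
qed

lemma sym_pos_def_matrix_inv:
  assumes "sym_pos_def S"
  shows "sym_pos_def (matrix_inv S)"
proof -
  have inv: "invertible S"
    using assms pos_def_imp_invertible by (auto simp: sym_pos_def_def)
  have SS: "S ** matrix_inv S = mat 1" "matrix_inv S ** S = mat 1"
    using matrix_inv_mult[OF inv] by auto
  have "transpose (matrix_inv S) ** S = mat 1"
    using SS(1) assms by (metis matrix_transpose_mul sym_pos_def_def transpose_mat)
  then have tr: "transpose (matrix_inv S) = matrix_inv S"
    using SS by (metis matrix_mul_assoc matrix_mul_lid matrix_mul_rid)
  have "x \<bullet> (matrix_inv S *v x) > 0" if "x \<noteq> 0" for x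
  proof -
    let ?y = "matrix_inv S *v x"
    have x: "S *v ?y = x"
      by (simp add: matrix_vector_mul_assoc SS)
    then have "?y \<noteq> 0" using that by auto
    then have "?y \<bullet> (S *v ?y) > 0"
      using assms by (simp add: sym_pos_def_def)
    then show ?thesis using x by (simp add: inner_commute)
  qed
  then show ?thesis using tr by (simp add: sym_pos_def_def)
qed

text \<open>A zero \<open>x\<close> of a nonnegative quadratic form minimises it, so the gradient \<open>B *v x\<close> vanishes; this is the
  score equation for the likelihood with \<open>J = 0\<close>. An invertible \<open>B\<close> then gives \<open>x = 0\<close>.\<close>

lemma sym_pos_def_iff_det_pos:
  fixes B :: "real^('n::finite \<times> 'n)^('n \<times> 'n)"
  assumes sym: "transpose B = B" and psd: "\<And>x. x \<bullet> (B *v x) \<ge> 0"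
  shows "sym_pos_def B \<longleftrightarrow> det B > 0"
proof
  assume "det B > 0"
  have "x = 0" if "x \<bullet> (B *v x) = 0" for x
  proof -
    have "is_mle 0 B x"
      using psd that by (auto simp: is_mle_on_def likelihood_def)
    then have "B *v x = 0"
      using interior_mle_solves_score_equation[OF sym] by fastforce
    then show "x = 0"
      using \<open>det B > 0\<close> by (metis invertible_det_nz invertible_left_inverse less_irrefl
          matrix_left_invertible_ker)
  qed
  then show "sym_pos_def B"
    using sym psd by (auto simp: sym_pos_def_def order.strict_iff_order)
qed (simp add: sym_pos_def_def pos_def_imp_det_pos)

text \<open>Completing the square: the log-likelihood at \<open>\<psi>\<close> falls short of its value at \<open>\<phi> = B\<^sup>-\<^sup>1 J\<close> by half the
  quadratic form at \<open>\<psi> - \<phi>\<close>.\<close>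

lemma mle_iff_of_sym_pos_def:
  assumes "sym_pos_def B"
  shows "is_mle J B \<phi> \<longleftrightarrow> \<phi> = matrix_inv B *v J"
proof -
  have sym: "transpose B = B" using assms by (simp add: sym_pos_def_def)
  have "invertible B"
    using assms pos_def_imp_invertible by (auto simp: sym_pos_def_def)
  then have inv: "B ** matrix_inv B = mat 1" "matrix_inv B ** B = mat 1"
    using matrix_inv_mult by auto
  have "is_mle J B \<phi>" if "B *v \<phi> = J"
    unfolding is_mle_on_def
  proof (intro conjI ballI UNIV_I)
    fix \<psi>
    have "\<psi> \<bullet> (B *v \<psi>) = \<phi> \<bullet> J + 2 * ((\<psi> - \<phi>) \<bullet> J) + (\<psi> - \<phi>) \<bullet> (B *v (\<psi> - \<phi>))"
      using quadratic_form_along_line[OF sym, of \<phi> 1 "\<psi> - \<phi>"] that by simp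
    moreover have "(\<psi> - \<phi>) \<bullet> (B *v (\<psi> - \<phi>)) \<ge> 0"
      using assms by (cases "\<psi> = \<phi>") (auto simp: sym_pos_def_def less_imp_le)
    ultimately show "likelihood J B \<psi> \<le> likelihood J B \<phi>"
      using that by (simp only: likelihood_def exp_le_cancel_iff inner_diff_left)
        (simp add: field_simps)
  qed
  moreover have "B *v \<phi> = J" if "is_mle J B \<phi>"
    using interior_mle_solves_score_equation[OF sym that] by simp
  moreover have "B *v \<phi> = J \<longleftrightarrow> \<phi> = matrix_inv B *v J"
    using inv by (metis matrix_vector_mul_assoc matrix_vector_mul_lid)
  ultimately show ?thesis by blast
qed

section \<open>Cadlag paths and their time integrals\<close>

lemma cadlag_on_left_limit:
  assumes "cadlag_on {0..} f" "0 < s"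
  obtains l where "(f \<longlongrightarrow> l) (at_left s)"
proof -
  obtain l where "(f \<longlongrightarrow> l) (at s within {0..} \<inter> {..<s})"
    using assms unfolding cadlag_on_def by fastforce
  moreover have "at s within {0..} \<inter> {..<s} = at_left s"
    using assms(2) by (intro at_within_nhd[of _ "{0<..}"]) auto
  ultimately show thesis using that by simp
qed

lemma cadlag_on_right_limit:
  assumes "cadlag_on {0..} f" "0 \<le> s"
  shows "(f \<longlongrightarrow> f s) (at_right s)"
proof -
  have "{0..} \<inter> {s<..} = {s<..}" using assms(2) by auto
  then show ?thesis using assms unfolding cadlag_on_def by (metis atLeast_iff)
qed

lemma cadlag_on_locally_bounded:
  fixes f :: "real \<Rightarrow> 'b::real_normed_vector"
  assumes "cadlag_on {0..} f" "0 \<le> s"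
  shows "\<exists>U K. open U \<and> s \<in> U \<and> (\<forall>r\<in>U \<inter> {0..}. norm (f r) \<le> K)"
proof -
  have bdd: "\<exists>K. \<forall>\<^sub>F r in G. norm (f r) \<le> K" if "(f \<longlongrightarrow> l) G" for l G
  proof -
    have "\<forall>\<^sub>F r in G. dist (f r) l < 1" using that by (rule tendstoD) simp
    then have "\<forall>\<^sub>F r in G. norm (f r) \<le> norm l + 1"
    proof (rule eventually_mono)
      fix r assume "dist (f r) l < 1"
      then show "norm (f r) \<le> norm l + 1"
        using norm_triangle_ineq2[of "f r" l] by (simp add: dist_norm)
    qed
    then show ?thesis by blast
  qed
  obtain l where "(f \<longlongrightarrow> l) (at s within {0..} \<inter> {..<s})"
    using assms unfolding cadlag_on_def by force
  from bdd[OF this] obtain K1 where K1: "\<forall>\<^sub>F r in at s within {0..} \<inter> {..<s}. norm (f r) \<le> K1" ..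
  have "(f \<longlongrightarrow> f s) (at s within {0..} \<inter> {s<..})"
    using assms unfolding cadlag_on_def by force
  from bdd[OF this] obtain K2 where K2: "\<forall>\<^sub>F r in at s within {0..} \<inter> {s<..}. norm (f r) \<le> K2" ..
  obtain U1 where U1: "open U1" "s \<in> U1" "\<forall>r\<in>U1. r \<noteq> s \<longrightarrow> r \<in> {0..} \<inter> {..<s} \<longrightarrow> norm (f r) \<le> K1"
    using K1 unfolding eventually_at_topological by blast
  obtain U2 where U2: "open U2" "s \<in> U2" "\<forall>r\<in>U2. r \<noteq> s \<longrightarrow> r \<in> {0..} \<inter> {s<..} \<longrightarrow> norm (f r) \<le> K2"
    using K2 unfolding eventually_at_topological by blast
  show ?thesis
  proof (intro exI[of _ "U1 \<inter> U2"] exI[of _ "max (norm (f s)) (max K1 K2)"] conjI ballI)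
    fix r assume r: "r \<in> U1 \<inter> U2 \<inter> {0..}"
    consider "r = s" | "r < s" | "r > s" by linarith
    then show "norm (f r) \<le> max (norm (f s)) (max K1 K2)"
      using r U1 U2 by cases (auto simp: le_max_iff_disj)
  qed (use U1 U2 in auto)
qed

text \<open>One-sided limits bound the path near each time, and finitely many such neighbourhoods cover a
  compact interval.\<close>

lemma cadlag_on_bounded:
  fixes f :: "real \<Rightarrow> 'b::real_normed_vector"
  assumes "cadlag_on {0..} f"
  obtains K where "0 \<le> K" "\<And>s. s \<in> {0..t} \<Longrightarrow> norm (f s) \<le> K"
proof -
  obtain U k where U: "\<And>s. s \<in> {0..t} \<Longrightarrow> open (U s)" "\<And>s. s \<in> {0..t} \<Longrightarrow> s \<in> U s"
    "\<And>s r. s \<in> {0..t} \<Longrightarrow> r \<in> U s \<Longrightarrow> 0 \<le> r \<Longrightarrow> norm (f r) \<le> k s"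
    using cadlag_on_locally_bounded[OF assms] by (metis IntI atLeastAtMost_iff atLeast_iff)
  obtain D where D: "D \<subseteq> {0..t}" "finite D" "{0..t} \<subseteq> (\<Union>s\<in>D. U s)"
    by (rule compactE_image[of "{0..t}" "{0..t}" U]) (use U in auto)
  have "norm (f r) \<le> (\<Sum>s\<in>D. \<bar>k s\<bar>)" if r: "r \<in> {0..t}" for r
  proof -
    obtain s where s: "s \<in> D" "r \<in> U s" using D(3) r by blast
    then have "norm (f r) \<le> \<bar>k s\<bar>" using U(3)[of s r] D r by auto
    also have "\<dots> \<le> (\<Sum>s\<in>D. \<bar>k s\<bar>)" using s D by (intro member_le_sum) auto
    finally show ?thesis .
  qed
  then show thesis by (intro that[of "\<Sum>s\<in>D. \<bar>k s\<bar>"]) (auto intro: sum_nonneg)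
qed

text \<open>The first time after \<open>s\<close> on the grid of mesh \<open>1 / (n + 1)\<close>, capped at \<open>t\<close>. It lies strictly after \<open>s\<close> until
  the cap, so that only right limits matter.\<close>

definition right_grid :: "real \<Rightarrow> nat \<Rightarrow> real \<Rightarrow> real" where
  "right_grid t n s = min t ((of_int \<lfloor>real (Suc n) * s\<rfloor> + 1) / real (Suc n))"

lemma right_grid_bounds:
  assumes "s \<in> {0..t}"
  shows "right_grid t n s \<in> {s..t}" "right_grid t n s \<le> s + 1 / real (Suc n)"
proof -
  have "real (Suc n) * s < of_int \<lfloor>real (Suc n) * s\<rfloor> + 1" by linarith
  then have "s \<le> (of_int \<lfloor>real (Suc n) * s\<rfloor> + 1) / real (Suc n)"
    by (simp add: pos_le_divide_eq mult.commute del: of_nat_Suc)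
  then show "right_grid t n s \<in> {s..t}" using assms by (simp add: right_grid_def)
  have "of_int \<lfloor>real (Suc n) * s\<rfloor> + 1 \<le> real (Suc n) * s + 1" by linarith
  then have "(of_int \<lfloor>real (Suc n) * s\<rfloor> + 1) / real (Suc n) \<le> (real (Suc n) * s + 1) / real (Suc n)"
    by (rule divide_right_mono) simp
  also have "\<dots> = s + 1 / real (Suc n)" by (simp add: field_simps)
  finally show "right_grid t n s \<le> s + 1 / real (Suc n)" by (simp add: right_grid_def)
qed

lemma right_continuous_along_right_grid:
  assumes lim: "(f \<longlongrightarrow> f s) (at_right s)" and s: "s \<in> {0..t}"
  shows "(\<lambda>n. f (right_grid t n s)) \<longlonglongrightarrow> f s"
proof -
  have "(\<lambda>n. s + 1 / real (Suc n)) \<longlonglongrightarrow> s + 0"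
    by (intro tendsto_add tendsto_const) (use LIMSEQ_inverse_real_of_nat in \<open>simp add: field_simps\<close>)
  then have upper: "(\<lambda>n. s + 1 / real (Suc n)) \<longlonglongrightarrow> s" by simp
  have "s \<le> right_grid t n s" for n
    using right_grid_bounds(1)[OF s, of n] by simp
  then have "(\<lambda>n. right_grid t n s) \<longlonglongrightarrow> s"
    using right_grid_bounds(2)[OF s]
    by (intro tendsto_sandwich[OF _ _ tendsto_const upper] always_eventually allI)
  moreover have "at s within {s..} = at_right s"
    unfolding at_within_def by (intro arg_cong2[where f = inf] arg_cong[where f = principal]) auto
  then have "continuous (at s within {s..}) f"
    using lim by (simp add: continuous_within)
  moreover have "\<forall>n. right_grid t n s \<in> {s..}"
    using right_grid_bounds(1)[OF s] by auto
  ultimately show ?thesis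
    unfolding continuous_within_sequentially o_def by simp
qed

text \<open>A right-continuous adapted process is progressively measurable: up to time \<open>t\<close> it is the limit of its
  values at the next grid time. The grid is countable and capped at \<open>t\<close>, so these approximations are
  measurable with respect to the \<open>\<sigma>\<close>-algebra at time \<open>t\<close>.\<close>

lemma cadlag_adapted_imp_progressive:
  fixes Y :: "real \<Rightarrow> 'a \<Rightarrow> 'b::euclidean_space"
  assumes adapted: "adapted F Y" and filt: "filtration \<Omega> F"
    and cadlag: "\<And>\<omega>. \<omega> \<in> \<Omega> \<Longrightarrow> cadlag_on {0..} (\<lambda>t. Y t \<omega>)"
  shows "(\<lambda>(\<omega>, s). indicator {0..t} s *\<^sub>R Y s \<omega>) \<in> borel_measurable (F t \<Otimes>\<^sub>M borel)"
proof (rule borel_measurable_LIMSEQ_metric)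
  let ?X = "\<lambda>n (\<omega>, s). indicator {0..t} s *\<^sub>R Y (right_grid t n s) \<omega>"
  fix n
  let ?g = "\<lambda>k::int. min t ((of_int k + 1) / real (Suc n))"
  have [measurable]: "(\<lambda>\<omega>. indicator {0..} (?g k) *\<^sub>R Y (?g k) \<omega>) \<in> borel_measurable (F t)" for k
  proof (cases "0 \<le> ?g k")
    case True
    have "subalgebra (F t) (F (?g k))"
      using filt unfolding subalgebra_def filtration_def by auto
    moreover have "Y (?g k) \<in> borel_measurable (F (?g k))"
      using adapted True unfolding adapted_def by blast
    ultimately have "Y (?g k) \<in> borel_measurable (F t)"
      by (rule measurable_from_subalg)
    then show ?thesis by measurable
  next
    case False
    then have "indicator {0..} (?g k) = (0 :: real)"
      by (simp only: indicator_simps atLeast_iff simp_thms)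
    then show ?thesis
      by (simp only: scaleR_zero_left measurable_const space_borel UNIV_I)
  qed
  have "(\<lambda>p. (\<lambda>\<omega>. indicator {0..} (?g \<lfloor>real (Suc n) * snd p\<rfloor>) *\<^sub>R Y (?g \<lfloor>real (Suc n) * snd p\<rfloor>) \<omega>) (fst p))
      \<in> borel_measurable (F t \<Otimes>\<^sub>M borel)"
    by (rule measurable_compose_countable[where g = "\<lambda>p. \<lfloor>real (Suc n) * snd p\<rfloor>"
        and f = "\<lambda>k p. indicator {0..} (?g k) *\<^sub>R Y (?g k) (fst p)"]) measurable
  then have "(\<lambda>p. indicator {0..t} (snd p) *\<^sub>R
      (indicator {0..} (?g \<lfloor>real (Suc n) * snd p\<rfloor>) *\<^sub>R Y (?g \<lfloor>real (Suc n) * snd p\<rfloor>) (fst p)))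
      \<in> borel_measurable (F t \<Otimes>\<^sub>M borel)"
    by (rule borel_measurable_scaleR[rotated]) measurable
  also have "(\<lambda>p. indicator {0..t} (snd p) *\<^sub>R
      (indicator {0..} (?g \<lfloor>real (Suc n) * snd p\<rfloor>) *\<^sub>R Y (?g \<lfloor>real (Suc n) * snd p\<rfloor>) (fst p))) = ?X n"
  proof
    fix p :: "'a \<times> real"
    show "indicator {0..t} (snd p) *\<^sub>R
      (indicator {0..} (?g \<lfloor>real (Suc n) * snd p\<rfloor>) *\<^sub>R Y (?g \<lfloor>real (Suc n) * snd p\<rfloor>) (fst p)) = ?X n p"
    proof (cases "snd p \<in> {0..t}")
      case True
      then have "0 \<le> right_grid t n (snd p)"
        using right_grid_bounds(1)[OF True, of n] by auto
      then show ?thesis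
        unfolding right_grid_def split_beta by (simp only: indicator_simps atLeast_iff simp_thms scaleR_one)
    qed (simp add: split_beta)
  qed
  finally show "?X n \<in> borel_measurable (F t \<Otimes>\<^sub>M borel)" .
next
  fix p assume "p \<in> space (F t \<Otimes>\<^sub>M (borel :: real measure))"
  then have "fst p \<in> \<Omega>"
    using filt by (auto simp: space_pair_measure filtration_def)
  then have "(\<lambda>n. Y (right_grid t n (snd p)) (fst p)) \<longlonglongrightarrow> Y (snd p) (fst p)" if "snd p \<in> {0..t}"
    using right_continuous_along_right_grid[OF cadlag_on_right_limit[OF cadlag] that] that by simp
  then show "(\<lambda>n. case p of (\<omega>, s) \<Rightarrow> indicator {0..t} s *\<^sub>R Y (right_grid t n s) \<omega>)
      \<longlonglongrightarrow> (case p of (\<omega>, s) \<Rightarrow> indicator {0..t} s *\<^sub>R Y s \<omega>)"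
    by (auto simp: split_beta indicator_def)
qed

lemma set_integrable_of_bounded:
  fixes g :: "real \<Rightarrow> 'b::euclidean_space"
  assumes meas: "(\<lambda>s. indicator {0..t} s *\<^sub>R g s) \<in> borel_measurable borel"
    and bdd: "\<And>s. s \<in> {0..t} \<Longrightarrow> norm (g s) \<le> K"
  shows "set_integrable lborel {0..t} g"
  unfolding set_integrable_def
proof (rule Bochner_Integration.integrable_bound)
  show "integrable lborel (\<lambda>s. indicator {0..t} s *\<^sub>R K)"
    by (cases "0 \<le> t") auto
  show "(\<lambda>s. indicator {0..t} s *\<^sub>R g s) \<in> borel_measurable lborel"
    using meas by simp
  show "AE s in lborel. norm (indicator {0..t} s *\<^sub>R g s) \<le> norm (indicator {0..t} s *\<^sub>R K)"
    using bdd by (intro AE_I2) (auto simp: indicator_def intro: order_trans[OF _ abs_ge_self])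
qed

lemma norm_set_integral_increment_le:
  fixes g :: "real \<Rightarrow> 'b::euclidean_space"
  assumes int: "set_integrable lborel {0..T} g" and bdd: "\<And>s. s \<in> {0..T} \<Longrightarrow> norm (g s) \<le> K"
    and rs: "0 \<le> r" "r \<le> s" "s \<le> T"
  shows "norm ((LINT u:{0..s}|lborel. g u) - (LINT u:{0..r}|lborel. g u)) \<le> K * (s - r)"
proof -
  have sub: "set_integrable lborel A g" if "A \<in> sets borel" "A \<subseteq> {0..T}" for A
    using set_integrable_subset[OF int] that by simp
  have "{0..s} = {0..r} \<union> {r<..s}" using rs by auto
  then have "(LINT u:{0..s}|lborel. g u) = (LINT u:{0..r}|lborel. g u) + (LINT u:{r<..s}|lborel. g u)"
    using rs by (simp only:) (intro set_integral_Un sub, auto)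
  then have "norm ((LINT u:{0..s}|lborel. g u) - (LINT u:{0..r}|lborel. g u)) = norm (LINT u:{r<..s}|lborel. g u)"
    by simp
  also have "\<dots> \<le> (LINT u|lborel. norm (indicator {r<..s} u *\<^sub>R g u))"
    unfolding set_lebesgue_integral_def by (rule integral_norm_bound)
  also have "\<dots> \<le> (LINT u|lborel. indicator {r<..s} u * K)"
  proof (rule integral_mono)
    show "integrable lborel (\<lambda>u. norm (indicator {r<..s} u *\<^sub>R g u))"
    proof (rule integrable_norm)
      have "{r<..s} \<subseteq> {0..T}" using rs by auto
      then show "integrable lborel (\<lambda>u. indicator {r<..s} u *\<^sub>R g u)"
        using sub[of "{r<..s}"] by (simp add: set_integrable_def)
    qed
    show "integrable lborel (\<lambda>u. indicator {r<..s} u * K)" using rs by auto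
    show "norm (indicator {r<..s} u *\<^sub>R g u) \<le> indicator {r<..s} u * K" for u
      using bdd[of u] rs by (auto simp: indicator_def)
  qed
  also have "\<dots> = K * (s - r)" using rs by simp
  finally show ?thesis .
qed

text \<open>The integrand of the Ornstein-Uhlenbeck drift is a limit of left-shifted copies of the path, so it is
  measurable. It inherits the bound of the path, except at time \<open>0\<close>: there the left limit runs over
  negative times and is an arbitrary vector, whose norm has to enter the bound.\<close>

lemma cadlag_left_limits_integrable:
  fixes f :: "real \<Rightarrow> real^'n"
  assumes cadlag: "cadlag_on {0..} f"
    and meas [measurable]: "(\<lambda>s. indicator {0..T} s *\<^sub>R f s) \<in> borel_measurable borel"
  obtains K where "set_integrable lborel {0..T} (\<lambda>s. Q *v Lim (at_left s) f)"
    "\<And>s. s \<in> {0..T} \<Longrightarrow> norm (Q *v Lim (at_left s) f) \<le> K"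
proof -
  obtain K0 where K0: "0 \<le> K0" "\<And>s. s \<in> {0..T} \<Longrightarrow> norm (f s) \<le> K0"
    using cadlag_on_bounded[OF cadlag] by blast
  let ?g = "\<lambda>s. Lim (at_left s) f"
  have lim: "(f \<longlongrightarrow> ?g s) (at_left s)" if "0 < s" for s
    using cadlag_on_left_limit[OF cadlag that] by (metis tendsto_Lim trivial_limit_at_left_real)
  have g_bound: "norm (?g s) \<le> K0 + norm (?g 0)" if s: "s \<in> {0..T}" for s
  proof (cases "s = 0")
    case False
    then have "0 < s" using s by simp
    have "norm (?g s) \<le> K0"
    proof (rule tendsto_upperbound[OF tendsto_norm[OF lim[OF \<open>0 < s\<close>]]])
      have "\<forall>\<^sub>F r in at_left s. 0 < r \<and> r < s"
        using \<open>0 < s\<close> eventually_at_left_real by (auto simp: greaterThanLessThan_def)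
      then show "\<forall>\<^sub>F r in at_left s. norm (f r) \<le> K0"
        by eventually_elim (use K0(2) s in auto)
    qed simp
    then show ?thesis by (simp add: add_increasing2)
  qed (use K0 in simp)
  let ?u = "\<lambda>n s. max 0 (s - 1 / real (Suc n))"
  have "(\<lambda>s. indicator {0<..T} s *\<^sub>R ?g s) \<in> borel_measurable borel"
  proof (rule borel_measurable_LIMSEQ_metric)
    fix n
    let ?f = "\<lambda>r. indicator {0..T} r *\<^sub>R f r"
    have "(\<lambda>s. ?f (?u n s)) \<in> borel_measurable borel"
      by (rule measurable_compose[OF _ meas]) measurable
    then show "(\<lambda>s. indicator {0<..T} s *\<^sub>R ?f (?u n s)) \<in> borel_measurable borel"
      by (rule borel_measurable_scaleR[rotated]) measurable
  next
    fix s :: real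
    show "(\<lambda>n. indicator {0<..T} s *\<^sub>R (indicator {0..T} (?u n s) *\<^sub>R f (?u n s))) \<longlonglongrightarrow> indicator {0<..T} s *\<^sub>R ?g s"
    proof (cases "s \<in> {0<..T}")
      case True
      have in_range: "?u n s \<in> {0..T}" "?u n s < s" for n
      proof -
        have "0 < 1 / real (Suc n)" by simp
        then have "s - 1 / real (Suc n) < s" by linarith
        then show "?u n s \<in> {0..T}" "?u n s < s"
          using True unfolding greaterThanAtMost_iff atLeastAtMost_iff by linarith+
      qed
      have "(\<lambda>n. 1 / real (Suc n)) \<longlonglongrightarrow> 0"
        using LIMSEQ_inverse_real_of_nat by (simp only: inverse_eq_divide)
      from tendsto_max[OF tendsto_const tendsto_diff[OF tendsto_const this], of 0 s]
      have "(\<lambda>n. ?u n s) \<longlonglongrightarrow> s"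
        using True by (simp only: diff_zero greaterThanAtMost_iff max.absorb2 less_imp_le)
      then have "filterlim (\<lambda>n. ?u n s) (at_left s) sequentially"
        unfolding filterlim_at using in_range(2)
        by (intro conjI always_eventually allI) (simp_all only: lessThan_iff less_imp_neq simp_thms)
      then have "(\<lambda>n. f (?u n s)) \<longlonglongrightarrow> ?g s"
        using True by (intro filterlim_compose[OF lim]) auto
      then show ?thesis
        using True in_range(1) by simp
    qed simp
  qed
  then have "(\<lambda>s. indicator {0<..T} s *\<^sub>R ?g s + indicator {0..T} 0 *\<^sub>R indicator {0} s *\<^sub>R ?g 0) \<in> borel_measurable borel"
    by measurable
  also have "(\<lambda>s. indicator {0<..T} s *\<^sub>R ?g s + indicator {0..T} 0 *\<^sub>R indicator {0} s *\<^sub>R ?g 0) =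
      (\<lambda>s. indicator {0..T} s *\<^sub>R ?g s)"
    by (auto simp: fun_eq_iff indicator_def)
  finally have "(\<lambda>s. Q *v (indicator {0..T} s *\<^sub>R ?g s)) \<in> borel_measurable borel"
    by (intro borel_measurable_continuous_on[where f = "(*v) Q"] matrix_vector_mult_linear_continuous_on)
  then have "(\<lambda>s. indicator {0..T} s *\<^sub>R (Q *v ?g s)) \<in> borel_measurable borel"
    by (simp add: matrix_vector_mult_scaleR)
  moreover have Qbound: "norm (Q *v ?g s) \<le> onorm ((*v) Q) * (K0 + norm (?g 0))" if "s \<in> {0..T}" for s
  proof -
    have "norm (Q *v ?g s) \<le> onorm ((*v) Q) * norm (?g s)"
      by (intro onorm matrix_vector_mul_bounded_linear)
    also have "\<dots> \<le> onorm ((*v) Q) * (K0 + norm (?g 0))"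
      using g_bound[OF that] by (intro mult_left_mono onorm_pos_le matrix_vector_mul_bounded_linear)
    finally show ?thesis .
  qed
  ultimately show thesis
    by (intro that[of "onorm ((*v) Q) * (K0 + norm (?g 0))"] set_integrable_of_bounded) blast+
qed

section \<open>The information matrix as a time integral\<close>

text \<open>Pairing \<open>v\<close> with the Kronecker product of \<open>y\<close> and \<open>g\<close> amounts to applying the matrix \<open>vec_inv v\<close> to \<open>y\<close>
  and pairing the result with \<open>g\<close>. This reduces quadratic forms of Kronecker products to those of the second factor.\<close>

lemma sum_pairs_vec_inv:
  "(\<Sum>p\<in>UNIV. v $ p * y $ fst p * g (snd p)) = (\<Sum>k\<in>UNIV. (vec_inv v *v y) $ k * g k)"
proof -
  have "(\<Sum>p\<in>UNIV. v $ p * y $ fst p * g (snd p)) = (\<Sum>i\<in>UNIV. \<Sum>k\<in>UNIV. v $ (i, k) * y $ i * g k)"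
    by (simp add: sum.cartesian_product split_beta flip: UNIV_Times_UNIV)
  also have "\<dots> = (\<Sum>k\<in>UNIV. \<Sum>i\<in>UNIV. v $ (i, k) * y $ i * g k)"
    by (rule sum.swap)
  finally show ?thesis
    by (simp add: matrix_vector_mult_def vec_inv_def sum_distrib_right)
qed

lemma inner_cov_vec_inv:
  "inner_cov \<Sigma> (vec_inv v *v y) (vec_inv w *v y) =
    (\<Sum>p\<in>UNIV. \<Sum>q\<in>UNIV. v $ p * matrix_inv \<Sigma> $ snd p $ snd q * w $ q * (y $ fst p * y $ fst q))"
proof -
  let ?z = "matrix_inv \<Sigma> *v (vec_inv w *v y)"
  have z: "?z $ k = (\<Sum>q\<in>UNIV. w $ q * y $ fst q * matrix_inv \<Sigma> $ k $ snd q)" for k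
    using sum_pairs_vec_inv[of w y "\<lambda>l. matrix_inv \<Sigma> $ k $ l"]
    by (simp add: matrix_vector_mult_def[of "matrix_inv \<Sigma>"] mult.commute)
  have "inner_cov \<Sigma> (vec_inv v *v y) (vec_inv w *v y) = (\<Sum>k\<in>UNIV. (vec_inv v *v y) $ k * ?z $ k)"
    by (simp add: inner_cov_def inner_vec_def)
  also have "\<dots> = (\<Sum>p\<in>UNIV. v $ p * y $ fst p * ?z $ snd p)"
    by (rule sum_pairs_vec_inv[symmetric])
  finally show ?thesis
    by (simp add: z sum_distrib_left mult_ac)
qed

lemma I_bracket_quadratic_form:
  fixes Y :: "real \<Rightarrow> 'a \<Rightarrow> real^'n"
  assumes int: "\<And>i j. set_integrable lborel {0..t} (\<lambda>s. Y s \<omega> $ i * Y s \<omega> $ j)"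
  shows "set_integrable lborel {0..t} (\<lambda>s. inner_cov \<Sigma> (vec_inv v *v Y s \<omega>) (vec_inv w *v Y s \<omega>))"
    and "v \<bullet> (I_bracket \<Sigma> Y t \<omega> *v w) =
      (LINT s:{0..t}|lborel. inner_cov \<Sigma> (vec_inv v *v Y s \<omega>) (vec_inv w *v Y s \<omega>))"
proof -
  let ?c = "\<lambda>p q. v $ p * matrix_inv \<Sigma> $ snd p $ snd q * w $ q"
  let ?g = "\<lambda>p q s. indicator {0..t} s *\<^sub>R (Y s \<omega> $ fst p * Y s \<omega> $ fst q)"
  have split: "(\<lambda>s. indicator {0..t} s *\<^sub>R inner_cov \<Sigma> (vec_inv v *v Y s \<omega>) (vec_inv w *v Y s \<omega>)) =
      (\<lambda>s. \<Sum>p\<in>UNIV. \<Sum>q\<in>UNIV. ?c p q * ?g p q s)"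
    unfolding inner_cov_vec_inv by (simp add: sum_distrib_left mult_ac)
  have g_int: "integrable lborel (\<lambda>s. ?c p q * ?g p q s)" for p q
    using int unfolding set_integrable_def by (intro integrable_mult_right)
  show "set_integrable lborel {0..t} (\<lambda>s. inner_cov \<Sigma> (vec_inv v *v Y s \<omega>) (vec_inv w *v Y s \<omega>))"
    unfolding set_integrable_def split by (intro Bochner_Integration.integrable_sum g_int)
  have "(LINT s:{0..t}|lborel. inner_cov \<Sigma> (vec_inv v *v Y s \<omega>) (vec_inv w *v Y s \<omega>)) =
      (\<Sum>p\<in>UNIV. \<Sum>q\<in>UNIV. LINT s|lborel. ?c p q * ?g p q s)"
    unfolding set_lebesgue_integral_def split
    by (simp only: Bochner_Integration.integral_sum Bochner_Integration.integrable_sum g_int)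
  also have "\<dots> = (\<Sum>p\<in>UNIV. \<Sum>q\<in>UNIV. ?c p q *
      (LINT s:{0..t}|lborel. Y s \<omega> $ fst p * Y s \<omega> $ fst q))"
    unfolding set_lebesgue_integral_def by (simp only: integral_mult_right_zero)
  finally have "(LINT s:{0..t}|lborel. inner_cov \<Sigma> (vec_inv v *v Y s \<omega>) (vec_inv w *v Y s \<omega>)) =
    (\<Sum>p\<in>UNIV. \<Sum>q\<in>UNIV. ?c p q * (LINT s:{0..t}|lborel. Y s \<omega> $ fst p * Y s \<omega> $ fst q))" .
  then show "v \<bullet> (I_bracket \<Sigma> Y t \<omega> *v w) =
      (LINT s:{0..t}|lborel. inner_cov \<Sigma> (vec_inv v *v Y s \<omega>) (vec_inv w *v Y s \<omega>))"
    by (simp add: I_bracket_def kron_def K_mat_def inner_vec_def matrix_vector_mult_def sum_distrib_left mult_ac)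
qed

lemma transpose_I_bracket:
  assumes "sym_pos_def \<Sigma>"
  shows "transpose (I_bracket \<Sigma> Y t \<omega>) = I_bracket \<Sigma> Y t \<omega>"
proof -
  have "transpose (matrix_inv \<Sigma>) = matrix_inv \<Sigma>"
    using sym_pos_def_matrix_inv[OF assms] by (simp add: sym_pos_def_def)
  moreover have "transpose (matrix_inv \<Sigma>) $ i $ j = matrix_inv \<Sigma> $ j $ i" for i j
    by (simp add: transpose_def)
  ultimately have sym: "matrix_inv \<Sigma> $ i $ j = matrix_inv \<Sigma> $ j $ i" for i j
    by simp
  have "K_mat Y t \<omega> $ i $ j = K_mat Y t \<omega> $ j $ i" for i j
    by (simp add: K_mat_def mult.commute)
  then have "I_bracket \<Sigma> Y t \<omega> $ q $ p = I_bracket \<Sigma> Y t \<omega> $ p $ q" for p q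
    unfolding I_bracket_def kron_def using sym[of "snd q" "snd p"] by simp
  then show ?thesis
    by (simp add: transpose_def vec_eq_iff)
qed

text \<open>If \<open>z s \<noteq> 0\<close>, then \<open>z\<close> has no zero on an interval to the right of \<open>s\<close>, which has positive length.\<close>

lemma AE_zero_imp_zero_of_right_limits:
  fixes z :: "real \<Rightarrow> 'b::real_normed_vector"
  assumes AE: "AE s in lborel. s \<in> {0..t} \<longrightarrow> z s = 0"
    and rc: "\<And>s. 0 \<le> s \<Longrightarrow> (z \<longlongrightarrow> z s) (at_right s)" and s: "s \<in> {0..<t}"
  shows "z s = 0"
proof (rule ccontr)
  assume "z s \<noteq> 0"
  then have "\<forall>\<^sub>F r in at_right s. z r \<noteq> 0"
    using rc[of s] s by (intro tendsto_imp_eventually_ne) auto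
  then obtain b where b: "b > s" "\<And>r. s < r \<Longrightarrow> r < b \<Longrightarrow> z r \<noteq> 0"
    unfolding eventually_at_right_field by blast
  have "AE r in lborel. r \<notin> {s<..<min b t}"
    using AE by eventually_elim (use b s in auto)
  then have "emeasure lborel {s<..<min b t} = 0"
    by (subst (asm) AE_iff_measurable[of "{s<..<min b t}"]) auto
  then show False using b s by auto
qed

text \<open>A nonnegative integrand with zero integral vanishes almost everywhere, by right-continuity everywhere on \<open>[0, t)\<close>.
  Any nonzero row of \<open>vec_inv v\<close> is then orthogonal to the path.\<close>

lemma I_bracket_degenerate_imp_hyperplane:
  fixes Y :: "real \<Rightarrow> 'a \<Rightarrow> real^'n"
  assumes int: "\<And>i j. set_integrable lborel {0..t} (\<lambda>s. Y s \<omega> $ i * Y s \<omega> $ j)"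
    and cov: "sym_pos_def \<Sigma>"
    and rc: "\<And>s. 0 \<le> s \<Longrightarrow> ((\<lambda>s. Y s \<omega>) \<longlongrightarrow> Y s \<omega>) (at_right s)"
    and v: "v \<noteq> 0" "v \<bullet> (I_bracket \<Sigma> Y t \<omega> *v v) \<le> 0"
  obtains x where "x \<noteq> 0" "\<And>s. s \<in> {0..<t} \<Longrightarrow> x \<bullet> Y s \<omega> = 0"
proof -
  let ?z = "\<lambda>s. vec_inv v *v Y s \<omega>"
  let ?q = "\<lambda>s. indicator {0..t} s *\<^sub>R inner_cov \<Sigma> (?z s) (?z s)"
  have pos: "inner_cov \<Sigma> y y > 0" if "y \<noteq> 0" for y
    using sym_pos_def_matrix_inv[OF cov] that by (auto simp: inner_cov_def sym_pos_def_def)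
  have nonneg: "?q s \<ge> 0" for s
    using pos[of "?z s"] by (cases "?z s = 0") (auto simp: inner_cov_def)
  have q_int: "integrable lborel ?q"
    using I_bracket_quadratic_form(1)[where Y = Y and \<omega> = \<omega>, OF int] unfolding set_integrable_def .
  have "(LINT s|lborel. ?q s) \<le> 0"
    using v(2) I_bracket_quadratic_form(2)[where Y = Y and \<omega> = \<omega>, OF int] unfolding set_lebesgue_integral_def by simp
  moreover have "(LINT s|lborel. ?q s) \<ge> 0"
    using nonneg by (rule Bochner_Integration.integral_nonneg)
  ultimately have "AE s in lborel. ?q s = 0"
    using integral_nonneg_eq_0_iff_AE[OF q_int] nonneg by auto
  then have AE: "AE s in lborel. s \<in> {0..t} \<longrightarrow> ?z s = 0"
  proof eventually_elim
    case (elim s)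
    then show ?case using pos[of "?z s"] by (auto simp: less_le)
  qed
  have rcz: "(?z \<longlongrightarrow> ?z s) (at_right s)" if "0 \<le> s" for s
    by (intro bounded_linear.tendsto[OF matrix_vector_mul_bounded_linear] rc that)
  obtain p where "v $ p \<noteq> 0" using v(1) by (auto simp: vec_eq_iff)
  then have "vec_inv v $ snd p $ fst p \<noteq> 0" by (simp add: vec_inv_def)
  then have "vec_inv v $ snd p \<noteq> 0" by auto
  moreover have "vec_inv v $ snd p \<bullet> Y s \<omega> = 0" if "s \<in> {0..<t}" for s
    using AE_zero_imp_zero_of_right_limits[OF AE rcz that]
    by (metis matrix_vector_mul_component zero_index)
  ultimately show thesis by (rule that)
qed

text \<open>The determinant is visibly a random variable at time \<open>t\<close>, so this equivalence transfers almost sure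
  positive definiteness to the restriction of the measure to the \<open>\<sigma>\<close>-algebra at time \<open>t\<close>.\<close>

lemma I_bracket_sym_pos_def_iff_det_pos:
  fixes Y :: "real \<Rightarrow> 'a \<Rightarrow> real^'n"
  assumes int: "\<And>i j. set_integrable lborel {0..t} (\<lambda>s. Y s \<omega> $ i * Y s \<omega> $ j)"
    and cov: "sym_pos_def \<Sigma>"
  shows "sym_pos_def (I_bracket \<Sigma> Y t \<omega>) \<longleftrightarrow> det (I_bracket \<Sigma> Y t \<omega>) > 0"
proof (rule sym_pos_def_iff_det_pos[OF transpose_I_bracket[OF cov]])
  fix v
  have "inner_cov \<Sigma> y y \<ge> 0" for y
    using sym_pos_def_matrix_inv[OF cov]
    by (cases "y = 0") (auto simp: inner_cov_def sym_pos_def_def less_imp_le)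
  then show "v \<bullet> (I_bracket \<Sigma> Y t \<omega> *v v) \<ge> 0"
    unfolding I_bracket_quadratic_form(2)[where Y = Y and \<omega> = \<omega>, OF int] set_lebesgue_integral_def
    by (intro Bochner_Integration.integral_nonneg) simp
qed

lemma borel_measurable_vec_nth: "(\<lambda>x :: real^'n. x $ i) \<in> borel_measurable borel"
  by (intro borel_measurable_continuous_onI continuous_intros)

lemma measurable_det_I_bracket:
  fixes Y :: "real \<Rightarrow> 'a \<Rightarrow> real^'n"
  assumes prog: "(\<lambda>(\<omega>, s). indicator {0..t} s *\<^sub>R Y s \<omega>) \<in> borel_measurable (G \<Otimes>\<^sub>M borel)"
  shows "(\<lambda>\<omega>. det (I_bracket \<Sigma> Y t \<omega>)) \<in> borel_measurable G"
proof -
  have X: "(\<lambda>p. indicator {0..t} (snd p) *\<^sub>R Y (snd p) (fst p)) \<in> borel_measurable (G \<Otimes>\<^sub>M borel)"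
    using prog by (simp add: split_beta')
  have [measurable]: "(\<lambda>\<omega>. K_mat Y t \<omega> $ i $ j) \<in> borel_measurable G" for i j
  proof -
    have "(\<lambda>p. (indicator {0..t} (snd p) *\<^sub>R Y (snd p) (fst p)) $ i *
        (indicator {0..t} (snd p) *\<^sub>R Y (snd p) (fst p)) $ j) \<in> borel_measurable (G \<Otimes>\<^sub>M borel)"
      by (intro borel_measurable_times measurable_compose[OF X] borel_measurable_vec_nth)
    also have "(\<lambda>p. (indicator {0..t} (snd p) *\<^sub>R Y (snd p) (fst p)) $ i *
        (indicator {0..t} (snd p) *\<^sub>R Y (snd p) (fst p)) $ j) =
        (\<lambda>(\<omega>, s). indicator {0..t} s *\<^sub>R (Y s \<omega> $ i * Y s \<omega> $ j))"
      by (auto simp: fun_eq_iff indicator_def)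
    finally have "(\<lambda>(\<omega>, s). indicator {0..t} s *\<^sub>R (Y s \<omega> $ i * Y s \<omega> $ j)) \<in> borel_measurable (G \<Otimes>\<^sub>M lborel)"
      by (simp cong: measurable_cong_sets)
    then have "(\<lambda>\<omega>. LINT s|lborel. indicator {0..t} s *\<^sub>R (Y s \<omega> $ i * Y s \<omega> $ j)) \<in> borel_measurable G"
      by (rule lborel.borel_measurable_lebesgue_integral)
    then show ?thesis by (simp add: K_mat_def set_lebesgue_integral_def)
  qed
  show ?thesis
    unfolding det_def I_bracket_def kron_def vec_lambda_beta by measurable
qed

section \<open>Small-time behaviour of the noise\<close>

lemma iexp_remainder_bounds:
  "cmod (iexp x - 1 - \<i> * complex_of_real x) \<le> x\<^sup>2 / 2" "cmod (iexp x - 1) \<le> 2"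
proof -
  show "cmod (iexp x - 1 - \<i> * complex_of_real x) \<le> x\<^sup>2 / 2"
    using iexp_approx1[of x 1] by (simp add: power2_eq_square algebra_simps diff_diff_eq)
  show "cmod (iexp x - 1) \<le> 2"
    using norm_triangle_ineq4[of "iexp x" 1] by simp
qed

text \<open>The integrand of the jump part of the Levy exponent.\<close>

definition jump_integrand :: "real^'n \<Rightarrow> real^'n \<Rightarrow> complex" where
  "jump_integrand u z =
    iexp (u \<bullet> z) - 1 - (if norm z \<le> 1 then \<i> * complex_of_real (u \<bullet> z) else 0)"

text \<open>The first bound is a dominating function that a Levy measure integrates, uniform in \<open>h\<close>; the second
  one gives pointwise convergence to zero as \<open>h\<close> tends to zero.\<close>

lemma jump_integrand_bound:
  assumes h: "0 < h" "h \<le> 1"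
  shows "cmod (h *\<^sub>R jump_integrand ((1 / sqrt h) *\<^sub>R u) z) \<le> (2 + (norm u)\<^sup>2) * min 1 ((norm z)\<^sup>2)"
    and "cmod (h *\<^sub>R jump_integrand ((1 / sqrt h) *\<^sub>R u) z) \<le> sqrt h * (2 + norm u * norm z)"
proof -
  let ?x = "((1 / sqrt h) *\<^sub>R u) \<bullet> z"
  have CS: "\<bar>u \<bullet> z\<bar> \<le> norm u * norm z" by (rule Cauchy_Schwarz_ineq2)
  have sq: "h * (?x\<^sup>2 / 2) = (u \<bullet> z)\<^sup>2 / 2"
    using h by (simp add: power_divide field_simps)
  show "cmod (h *\<^sub>R jump_integrand ((1 / sqrt h) *\<^sub>R u) z) \<le> (2 + (norm u)\<^sup>2) * min 1 ((norm z)\<^sup>2)"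
  proof (cases "norm z \<le> 1")
    case True
    then have "cmod (h *\<^sub>R jump_integrand ((1 / sqrt h) *\<^sub>R u) z) \<le> h * (?x\<^sup>2 / 2)"
      using iexp_remainder_bounds(1)[of ?x] h unfolding jump_integrand_def norm_scaleR
      by (intro mult_mono) auto
    also have "\<dots> \<le> (norm u * norm z)\<^sup>2"
      unfolding sq using power_mono[OF CS, of 2] by (simp, smt (verit) zero_le_power2)
    also have "\<dots> \<le> (2 + (norm u)\<^sup>2) * (norm z)\<^sup>2"
      by (simp add: power_mult_distrib algebra_simps)
    also have "(norm z)\<^sup>2 = min 1 ((norm z)\<^sup>2)"
      using True by (simp add: power_le_one)
    finally show ?thesis .
  next
    case False
    then have "1 \<le> (norm z)\<^sup>2" by simp
    moreover have "cmod (h *\<^sub>R jump_integrand ((1 / sqrt h) *\<^sub>R u) z) \<le> 1 * 2"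
      using iexp_remainder_bounds(2)[of ?x] h False unfolding jump_integrand_def norm_scaleR
      by (intro mult_mono) auto
    ultimately show ?thesis by (simp add: add_increasing2)
  qed
  have "cmod (jump_integrand ((1 / sqrt h) *\<^sub>R u) z) \<le> 2 + \<bar>?x\<bar>"
  proof -
    have "cmod (\<i> * complex_of_real ?x) = \<bar>?x\<bar>"
      by (simp only: norm_mult norm_ii norm_of_real mult_1)
    moreover have "cmod (iexp ?x - 1 - 0) \<le> 2 + \<bar>?x\<bar>"
      using iexp_remainder_bounds(2)[of ?x] by (simp only: diff_zero add_increasing2 abs_ge_zero)
    ultimately show ?thesis
      using iexp_remainder_bounds(2)[of ?x] norm_triangle_ineq4[of "iexp ?x - 1" "\<i> * complex_of_real ?x"]
      unfolding jump_integrand_def by (cases "norm z \<le> 1") (simp_all only: if_True if_False)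
  qed
  also have "\<dots> \<le> 2 + norm u * norm z / sqrt h"
    using CS h by (simp add: field_simps abs_mult)
  finally have "cmod (h *\<^sub>R jump_integrand ((1 / sqrt h) *\<^sub>R u) z) \<le> h * (2 + norm u * norm z / sqrt h)"
    using h by (simp add: norm_scaleR)
  also have "\<dots> = h * 2 + sqrt h * (norm u * norm z)"
    using h by (simp add: distrib_left real_div_sqrt flip: times_divide_eq_left)
  also have "\<dots> \<le> sqrt h * 2 + sqrt h * (norm u * norm z)"
    using h real_le_rsqrt[of h h] by (simp add: power2_eq_square mult_le_one mult_left_le)
  finally show "cmod (h *\<^sub>R jump_integrand ((1 / sqrt h) *\<^sub>R u) z) \<le> sqrt h * (2 + norm u * norm z)"
    by (simp add: algebra_simps)
qed

text \<open>Under the Brownian scaling of space by \<open>1 / sqrt h\<close>, the Gaussian part of the exponent is invariant,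
  the drift is of order \<open>sqrt h\<close>, and the jump part tends to zero by dominated convergence.\<close>

lemma levy_exponent_small_time_scaling:
  fixes \<nu> :: "(real^'n) measure"
  assumes nu: "levy_measure \<nu>" and h: "\<And>n. 0 < h n" "\<And>n. h n \<le> 1" "h \<longlonglongrightarrow> 0"
  shows "(\<lambda>n. complex_of_real (h n) * levy_exponent b \<Sigma> \<nu> ((1 / sqrt (h n)) *\<^sub>R u))
    \<longlonglongrightarrow> - complex_of_real (u \<bullet> (\<Sigma> *v u)) / 2"
proof -
  let ?u = "\<lambda>n. (1 / sqrt (h n)) *\<^sub>R u"
  have sets [measurable_cong]: "sets \<nu> = sets borel"
    using nu by (simp add: levy_measure_def)
  have int: "integrable \<nu> (\<lambda>z. (2 + (norm u)\<^sup>2) * min 1 ((norm z)\<^sup>2))"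
    by (intro integrable_mult_right integrableI_nonneg) (use nu in \<open>auto simp: levy_measure_def\<close>)
  have sqrt_lim: "(\<lambda>n. sqrt (h n)) \<longlonglongrightarrow> 0"
    using tendsto_real_sqrt[OF h(3)] by simp
  have "(\<lambda>n. LINT z|\<nu>. h n *\<^sub>R jump_integrand (?u n) z) \<longlonglongrightarrow> (LINT z|\<nu>. 0)"
  proof (rule integral_dominated_convergence[OF _ _ int])
    show "AE z in \<nu>. (\<lambda>n. h n *\<^sub>R jump_integrand (?u n) z) \<longlonglongrightarrow> 0"
    proof (rule AE_I2)
      fix z :: "real^'n"
      have "(\<lambda>n. sqrt (h n) * (2 + norm u * norm z)) \<longlonglongrightarrow> 0"
        using tendsto_mult_right[OF sqrt_lim] by simp
      then show "(\<lambda>n. h n *\<^sub>R jump_integrand (?u n) z) \<longlonglongrightarrow> 0"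
        by (rule Lim_null_comparison[rotated])
          (intro always_eventually allI jump_integrand_bound(2) h)
    qed
    show "AE z in \<nu>. cmod (h n *\<^sub>R jump_integrand (?u n) z) \<le> (2 + (norm u)\<^sup>2) * min 1 ((norm z)\<^sup>2)" for n
      by (intro AE_I2 jump_integrand_bound(1) h)
  qed (auto simp: jump_integrand_def)
  then have jumps: "(\<lambda>n. complex_of_real (h n) * (LINT z|\<nu>. jump_integrand (?u n) z)) \<longlonglongrightarrow> 0"
    by (simp add: scaleR_conv_of_real)
  have drift: "(\<lambda>n. \<i> * complex_of_real (sqrt (h n) * (u \<bullet> b))) \<longlonglongrightarrow> \<i> * complex_of_real (0 * (u \<bullet> b))"
    by (intro tendsto_intros sqrt_lim)
  have "complex_of_real (h n) * levy_exponent b \<Sigma> \<nu> (?u n) =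
      \<i> * complex_of_real (sqrt (h n) * (u \<bullet> b)) - complex_of_real (u \<bullet> (\<Sigma> *v u)) / 2
      + complex_of_real (h n) * (LINT z|\<nu>. jump_integrand (?u n) z)" for n
  proof -
    have drift_eq: "h n * (?u n \<bullet> b) = sqrt (h n) * (u \<bullet> b)"
      using real_div_sqrt[of "h n"] h(1)[of n] by (simp flip: times_divide_eq_left)
    have gauss_eq: "h n * (?u n \<bullet> (\<Sigma> *v ?u n)) = u \<bullet> (\<Sigma> *v u)"
      using h(1)[of n] by (simp add: matrix_vector_mult_scaleR)
    have "complex_of_real a * (\<i> * complex_of_real x - complex_of_real q / 2 + j) =
        \<i> * complex_of_real (a * x) - complex_of_real (a * q) / 2 + complex_of_real a * j" for a x q j
      by (simp add: algebra_simps)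
    from this[of "h n" "?u n \<bullet> b" "?u n \<bullet> (\<Sigma> *v ?u n)" "LINT z|\<nu>. jump_integrand (?u n) z"] show ?thesis
      unfolding levy_exponent_def jump_integrand_def[symmetric] drift_eq gauss_eq .
  qed
  then show ?thesis
    using tendsto_add[OF tendsto_diff[OF drift tendsto_const] jumps] by simp
qed

lemma levy_process_measurable: "levy_process P L b \<Sigma> \<nu> \<Longrightarrow> L s \<in> borel_measurable P"
  unfolding levy_process_def by blast

lemma levy_process_small_time_char:
  assumes levy: "levy_process P L b \<Sigma> \<nu>" and h: "\<And>n. 0 < h n" "\<And>n. h n \<le> 1" "h \<longlonglongrightarrow> 0"
  shows "(\<lambda>n. LINT \<omega>|P. iexp (u \<bullet> L (h n) \<omega> / sqrt (h n)))
    \<longlonglongrightarrow> exp (- complex_of_real (u \<bullet> (\<Sigma> *v u)) / 2)"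
proof -
  have "(\<lambda>n. exp (complex_of_real (h n) * levy_exponent b \<Sigma> \<nu> ((1 / sqrt (h n)) *\<^sub>R u)))
    \<longlonglongrightarrow> exp (- complex_of_real (u \<bullet> (\<Sigma> *v u)) / 2)"
    using levy h by (intro tendsto_exp levy_exponent_small_time_scaling) (auto simp: levy_process_def)
  moreover have "exp (complex_of_real (h n) * levy_exponent b \<Sigma> \<nu> ((1 / sqrt (h n)) *\<^sub>R u)) =
      (LINT \<omega>|P. iexp (u \<bullet> L (h n) \<omega> / sqrt (h n)))" for n
  proof -
    have "(LINT \<omega>|P. iexp (((1 / sqrt (h n)) *\<^sub>R u) \<bullet> L (h n) \<omega>)) =
        exp (complex_of_real (h n) * levy_exponent b \<Sigma> \<nu> ((1 / sqrt (h n)) *\<^sub>R u))"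
      using levy h(1)[of n] unfolding levy_process_def by (meson less_imp_le)
    then show ?thesis by simp
  qed
  ultimately show ?thesis by simp
qed

text \<open>Convergence of the characteristic functions, hence weak convergence by Levy's continuity theorem.
  Directions are treated one at a time, so that the theorem on the real line suffices.\<close>

lemma levy_process_small_time_normal:
  assumes levy: "levy_process P L b \<Sigma> \<nu>" and P: "prob_space P"
    and h: "\<And>n. 0 < h n" "\<And>n. h n \<le> 1" "h \<longlonglongrightarrow> 0"
    and \<sigma>: "0 < \<sigma>" "\<sigma>\<^sup>2 = u \<bullet> (\<Sigma> *v u)"
  shows "weak_conv_m (\<lambda>n. distr P borel (\<lambda>\<omega>. (u \<bullet> L (h n) \<omega>) / (sqrt (h n) * \<sigma>)))
    std_normal_distribution"
proof (rule levy_continuity)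
  interpret prob_space P by fact
  have [measurable]: "L s \<in> borel_measurable P" for s
    by (rule levy_process_measurable[OF levy])
  show "real_distribution (distr P borel (\<lambda>\<omega>. (u \<bullet> L (h n) \<omega>) / (sqrt (h n) * \<sigma>)))" for n
    by (intro real_distribution_distr) measurable
  fix t :: real
  let ?v = "(t / \<sigma>) *\<^sub>R u"
  have "?v \<bullet> (\<Sigma> *v ?v) = t\<^sup>2"
    using \<sigma> by (simp add: matrix_vector_mult_scaleR power2_eq_square flip: \<sigma>(2))
  then have "(\<lambda>n. LINT \<omega>|P. iexp (?v \<bullet> L (h n) \<omega> / sqrt (h n))) \<longlonglongrightarrow> exp (- complex_of_real (t\<^sup>2) / 2)"
    using levy_process_small_time_char[OF levy h, of ?v] by (simp only:)
  moreover have "(LINT \<omega>|P. iexp (?v \<bullet> L (h n) \<omega> / sqrt (h n))) =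
      char (distr P borel (\<lambda>\<omega>. (u \<bullet> L (h n) \<omega>) / (sqrt (h n) * \<sigma>))) t" for n
    unfolding char_def by (subst integral_distr) (auto simp: mult_ac)
  ultimately show "(\<lambda>n. char (distr P borel (\<lambda>\<omega>. (u \<bullet> L (h n) \<omega>) / (sqrt (h n) * \<sigma>))) t)
      \<longlonglongrightarrow> char std_normal_distribution t"
    by (simp add: char_std_normal_distribution exp_of_real[symmetric])
qed (rule real_dist_normal_dist)

lemma isCont_cdf_std_normal: "isCont (cdf std_normal_distribution) x"
proof -
  interpret real_distribution std_normal_distribution by (rule real_dist_normal_dist)
  have "emeasure std_normal_distribution {x} = 0"
    by (subst emeasure_density) (auto intro!: nn_integral_0_iff_AE[THEN iffD2] AE_I[of _ _ "{x}"])
  then show ?thesis by (simp add: isCont_cdf measure_def)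
qed

context
  fixes P :: "'a measure" and L :: "real \<Rightarrow> 'a \<Rightarrow> real^'n" and b \<Sigma> \<nu> and h :: "nat \<Rightarrow> real"
  assumes levy: "levy_process P L b \<Sigma> \<nu>" and P: "prob_space P" and cov: "sym_pos_def \<Sigma>"
    and h: "\<And>n. 0 < h n" "\<And>n. h n \<le> 1" "h \<longlonglongrightarrow> 0"
begin

interpretation prob_space P by (rule P)

lemmas [measurable] = levy_process_measurable[OF levy]

lemma levy_small_time_cdf:
  assumes "u \<noteq> 0"
  obtains \<sigma> where "0 < \<sigma>" "\<And>x. (\<lambda>n. cdf (distr P borel (\<lambda>\<omega>. (u \<bullet> L (h n) \<omega>) / (sqrt (h n) * \<sigma>))) x)
    \<longlonglongrightarrow> cdf std_normal_distribution x"
proof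
  let ?\<sigma> = "sqrt (u \<bullet> (\<Sigma> *v u))"
  have pos: "u \<bullet> (\<Sigma> *v u) > 0"
    using assms cov by (auto simp: sym_pos_def_def)
  then show "0 < ?\<sigma>" by simp
  fix x
  show "(\<lambda>n. cdf (distr P borel (\<lambda>\<omega>. (u \<bullet> L (h n) \<omega>) / (sqrt (h n) * ?\<sigma>))) x)
    \<longlonglongrightarrow> cdf std_normal_distribution x"
    using levy_process_small_time_normal[OF levy P h, of ?\<sigma> u] pos isCont_cdf_std_normal
    unfolding weak_conv_m_def weak_conv_def by auto
qed

text \<open>The limiting normal law has no atom at zero, so it gives small intervals around zero small mass.
  Distribution functions measure half-open intervals, so \<open>[-e, e]\<close> is enlarged to \<open>(-2 e, e]\<close> on the
  normalised scale.\<close>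

lemma levy_small_time_no_atom:
  assumes u: "u \<noteq> 0" and p: "0 < p"
  obtains \<eta> where "0 < \<eta>"
    "\<forall>\<^sub>F n in sequentially. prob {\<omega>\<in>space P. \<bar>u \<bullet> L (h n) \<omega>\<bar> \<le> \<eta> * sqrt (h n)} < p"
proof -
  obtain \<sigma> where \<sigma>: "0 < \<sigma>" and conv: "\<And>x. (\<lambda>n. cdf (distr P borel (\<lambda>\<omega>. (u \<bullet> L (h n) \<omega>) / (sqrt (h n) * \<sigma>))) x)
    \<longlonglongrightarrow> cdf std_normal_distribution x" (is "\<And>x. (\<lambda>n. cdf (?D n) x) \<longlonglongrightarrow> ?\<Phi> x")
    using levy_small_time_cdf[OF u] by blast
  have "((\<lambda>e. ?\<Phi> (1 * e) - ?\<Phi> ((- 2) * e)) \<longlongrightarrow> ?\<Phi> (1 * 0) - ?\<Phi> ((- 2) * 0)) (at_right 0)"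
    by (intro tendsto_diff isCont_tendsto_compose[OF isCont_cdf_std_normal] tendsto_intros)
  then have "((\<lambda>e. ?\<Phi> e - ?\<Phi> (- 2 * e)) \<longlongrightarrow> 0) (at_right 0)"
    by simp
  then have "\<forall>\<^sub>F e in at_right 0. ?\<Phi> e - ?\<Phi> (- 2 * e) < p"
    using p by (rule order_tendstoD)
  then have "\<forall>\<^sub>F e in at_right 0. 0 < e \<and> ?\<Phi> e - ?\<Phi> (- 2 * e) < p"
    using eventually_at_right_less[of 0] by eventually_elim simp
  then obtain e where e: "0 < e" "?\<Phi> e - ?\<Phi> (- 2 * e) < p"
    using eventually_happens[of _ "at_right (0::real)"] by auto
  have "(\<lambda>n. cdf (?D n) e - cdf (?D n) (- 2 * e)) \<longlonglongrightarrow> ?\<Phi> e - ?\<Phi> (- 2 * e)"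
    by (intro tendsto_diff conv)
  then have "\<forall>\<^sub>F n in sequentially. cdf (?D n) e - cdf (?D n) (- 2 * e) < p"
    using e(2) by (rule order_tendstoD)
  then have "\<forall>\<^sub>F n in sequentially. prob {\<omega>\<in>space P. \<bar>u \<bullet> L (h n) \<omega>\<bar> \<le> (\<sigma> * e) * sqrt (h n)} < p"
  proof eventually_elim
    case (elim n)
    interpret D: real_distribution "?D n"
      by (intro real_distribution_distr) measurable
    have hs: "0 < sqrt (h n) * \<sigma>" using h \<sigma> by simp
    have "cdf (?D n) e - cdf (?D n) (- 2 * e) = measure (?D n) {- 2 * e<..e}"
      using e by (intro D.cdf_diff_eq) auto
    also have "\<dots> = prob ((\<lambda>\<omega>. (u \<bullet> L (h n) \<omega>) / (sqrt (h n) * \<sigma>)) -` {- 2 * e<..e} \<inter> space P)"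
      by (rule measure_distr) auto
    also have "\<dots> \<ge> prob {\<omega>\<in>space P. \<bar>u \<bullet> L (h n) \<omega>\<bar> \<le> (\<sigma> * e) * sqrt (h n)}"
    proof (rule finite_measure_mono)
      show "{\<omega>\<in>space P. \<bar>u \<bullet> L (h n) \<omega>\<bar> \<le> (\<sigma> * e) * sqrt (h n)} \<subseteq>
        (\<lambda>\<omega>. (u \<bullet> L (h n) \<omega>) / (sqrt (h n) * \<sigma>)) -` {- 2 * e<..e} \<inter> space P"
      proof (rule subsetI)
        fix \<omega> assume \<omega>: "\<omega> \<in> {\<omega>\<in>space P. \<bar>u \<bullet> L (h n) \<omega>\<bar> \<le> (\<sigma> * e) * sqrt (h n)}"
        then have "\<bar>u \<bullet> L (h n) \<omega>\<bar> \<le> (\<sigma> * e) * sqrt (h n)" by simp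
        then have "\<bar>(u \<bullet> L (h n) \<omega>) / (sqrt (h n) * \<sigma>)\<bar> \<le> e"
          using hs by (simp only: abs_divide abs_of_pos pos_divide_le_eq) (simp add: mult_ac)
        then have "(u \<bullet> L (h n) \<omega>) / (sqrt (h n) * \<sigma>) \<in> {- 2 * e<..e}"
          using e(1) unfolding abs_le_iff greaterThanAtMost_iff by linarith
        then show "\<omega> \<in> (\<lambda>\<omega>. (u \<bullet> L (h n) \<omega>) / (sqrt (h n) * \<sigma>)) -` {- 2 * e<..e} \<inter> space P"
          using \<omega> by blast
      qed
    qed measurable
    finally show ?case using elim by linarith
  qed
  then show thesis using that[of "\<sigma> * e"] \<sigma> e by simp
qed

lemma levy_small_time_tight_direction:
  assumes u: "u \<noteq> 0" and p: "0 < p"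
  obtains M where "0 < M"
    "\<forall>\<^sub>F n in sequentially. prob {\<omega>\<in>space P. \<bar>u \<bullet> L (h n) \<omega>\<bar> > M * sqrt (h n)} < p"
proof -
  obtain \<sigma> where \<sigma>: "0 < \<sigma>" and conv: "\<And>x. (\<lambda>n. cdf (distr P borel (\<lambda>\<omega>. (u \<bullet> L (h n) \<omega>) / (sqrt (h n) * \<sigma>))) x)
    \<longlonglongrightarrow> cdf std_normal_distribution x" (is "\<And>x. (\<lambda>n. cdf (?D n) x) \<longlonglongrightarrow> ?\<Phi> x")
    using levy_small_time_cdf[OF u] by blast
  interpret N: real_distribution std_normal_distribution by (rule real_dist_normal_dist)
  have "((\<lambda>m. ?\<Phi> (- m)) \<longlongrightarrow> 0) at_top"
    by (rule filterlim_compose[OF N.cdf_lim_at_bot filterlim_uminus_at_bot_at_top])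
  then have "((\<lambda>m. ?\<Phi> m - ?\<Phi> (- m)) \<longlongrightarrow> 1 - 0) at_top"
    by (intro tendsto_diff N.cdf_lim_at_top_prob)
  then have "\<forall>\<^sub>F m in at_top. ?\<Phi> m - ?\<Phi> (- m) > 1 - p"
    by (rule order_tendstoD) (use p in simp)
  then have "\<forall>\<^sub>F m in at_top. 0 < m \<and> ?\<Phi> m - ?\<Phi> (- m) > 1 - p"
    using eventually_gt_at_top[of 0] by eventually_elim simp
  then obtain m where m: "0 < m" "?\<Phi> m - ?\<Phi> (- m) > 1 - p"
    using eventually_happens[of _ "at_top :: real filter"] by auto
  have "(\<lambda>n. cdf (?D n) m - cdf (?D n) (- m)) \<longlonglongrightarrow> ?\<Phi> m - ?\<Phi> (- m)"
    by (intro tendsto_diff conv)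
  then have "\<forall>\<^sub>F n in sequentially. cdf (?D n) m - cdf (?D n) (- m) > 1 - p"
    using m(2) by (rule order_tendstoD)
  then have "\<forall>\<^sub>F n in sequentially. prob {\<omega>\<in>space P. \<bar>u \<bullet> L (h n) \<omega>\<bar> > (\<sigma> * m) * sqrt (h n)} < p"
  proof eventually_elim
    case (elim n)
    interpret D: real_distribution "?D n"
      by (intro real_distribution_distr) measurable
    have hs: "0 < sqrt (h n) * \<sigma>" using h \<sigma> by simp
    let ?A = "(\<lambda>\<omega>. (u \<bullet> L (h n) \<omega>) / (sqrt (h n) * \<sigma>)) -` {- m<..m} \<inter> space P"
    have "cdf (?D n) m - cdf (?D n) (- m) = measure (?D n) {- m<..m}"
      using m by (intro D.cdf_diff_eq) auto
    also have "\<dots> = prob ?A"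
      by (rule measure_distr) auto
    finally have "prob ?A > 1 - p" using elim by simp
    moreover have "prob {\<omega>\<in>space P. \<bar>u \<bullet> L (h n) \<omega>\<bar> > (\<sigma> * m) * sqrt (h n)} \<le> prob (space P - ?A)"
    proof (rule finite_measure_mono)
      show "{\<omega>\<in>space P. \<bar>u \<bullet> L (h n) \<omega>\<bar> > (\<sigma> * m) * sqrt (h n)} \<subseteq> space P - ?A"
      proof safe
        fix \<omega> assume "\<bar>u \<bullet> L (h n) \<omega>\<bar> > (\<sigma> * m) * sqrt (h n)"
          and *: "(u \<bullet> L (h n) \<omega>) / (sqrt (h n) * \<sigma>) \<in> {- m<..m}"
        then have "\<bar>(u \<bullet> L (h n) \<omega>) / (sqrt (h n) * \<sigma>)\<bar> > m"
          using hs by (simp only: abs_divide abs_of_pos pos_less_divide_eq) (simp add: mult_ac)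
        then show False
          using * by (simp only: greaterThanAtMost_iff) linarith
      qed
    qed measurable
    moreover have "prob (space P - ?A) = 1 - prob ?A"
      by (rule prob_compl) measurable
    ultimately show ?case by linarith
  qed
  then show thesis using that[of "\<sigma> * m"] \<sigma> m by simp
qed

text \<open>Tightness in each coordinate direction; the norm is at most the sum of the absolute coordinates, so
  one coordinate must be large if the norm is.\<close>

lemma levy_small_time_tight:
  assumes p: "0 < p"
  obtains M where "0 < M"
    "\<forall>\<^sub>F n in sequentially. prob {\<omega>\<in>space P. norm (L (h n) \<omega>) > M * sqrt (h n)} < p"
proof -
  have "\<forall>i :: 'n. \<exists>M. 0 < M \<and> (\<forall>\<^sub>F n in sequentially.
      prob {\<omega>\<in>space P. \<bar>axis i 1 \<bullet> L (h n) \<omega>\<bar> > M * sqrt (h n)} < p / CARD('n))"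
  proof
    fix i :: 'n
    show "\<exists>M. 0 < M \<and> (\<forall>\<^sub>F n in sequentially.
      prob {\<omega>\<in>space P. \<bar>axis i 1 \<bullet> L (h n) \<omega>\<bar> > M * sqrt (h n)} < p / CARD('n))"
    proof (rule levy_small_time_tight_direction[of "axis i 1" "p / CARD('n)"])
      show "axis i (1::real) \<noteq> 0" by (simp add: axis_eq_0_iff)
      show "0 < p / CARD('n)" using p by simp
    qed (intro exI conjI)
  qed
  from choice[OF this] obtain M where "\<forall>i :: 'n. 0 < M i \<and> (\<forall>\<^sub>F n in sequentially.
      prob {\<omega>\<in>space P. \<bar>axis i 1 \<bullet> L (h n) \<omega>\<bar> > M i * sqrt (h n)} < p / CARD('n))" ..
  then have M: "\<And>i::'n. 0 < M i" "\<And>i. \<forall>\<^sub>F n in sequentially.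
      prob {\<omega>\<in>space P. \<bar>axis i 1 \<bullet> L (h n) \<omega>\<bar> > M i * sqrt (h n)} < p / CARD('n)"
    by simp_all
  have "\<forall>\<^sub>F n in sequentially. \<forall>i\<in>UNIV.
      prob {\<omega>\<in>space P. \<bar>axis i 1 \<bullet> L (h n) \<omega>\<bar> > M i * sqrt (h n)} < p / CARD('n)"
    by (intro eventually_ball_finite ballI M) auto
  then have "\<forall>\<^sub>F n in sequentially.
      prob {\<omega>\<in>space P. norm (L (h n) \<omega>) > (\<Sum>i\<in>UNIV. M i) * sqrt (h n)} < p"
  proof eventually_elim
    case (elim n)
    let ?A = "\<lambda>i. {\<omega>\<in>space P. \<bar>axis i 1 \<bullet> L (h n) \<omega>\<bar> > M i * sqrt (h n)}"
    have "{\<omega>\<in>space P. norm (L (h n) \<omega>) > (\<Sum>i\<in>UNIV. M i) * sqrt (h n)} \<subseteq> (\<Union>i\<in>UNIV. ?A i)"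
    proof (rule subsetI, rule ccontr)
      fix \<omega> assume \<omega>: "\<omega> \<in> {\<omega>\<in>space P. norm (L (h n) \<omega>) > (\<Sum>i\<in>UNIV. M i) * sqrt (h n)}"
        and not: "\<omega> \<notin> (\<Union>i\<in>UNIV. ?A i)"
      then have "\<bar>L (h n) \<omega> $ i\<bar> \<le> M i * sqrt (h n)" for i
        by (force simp: inner_axis' not_less)
      then have "(\<Sum>i\<in>UNIV. \<bar>L (h n) \<omega> $ i\<bar>) \<le> (\<Sum>i\<in>UNIV. M i * sqrt (h n))"
        by (intro sum_mono)
      then show False
        using \<omega> norm_le_l1_cart[of "L (h n) \<omega>"] by (simp add: sum_distrib_right)
    qed
    then have "prob {\<omega>\<in>space P. norm (L (h n) \<omega>) > (\<Sum>i\<in>UNIV. M i) * sqrt (h n)} \<le> prob (\<Union>i\<in>UNIV. ?A i)"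
      by (intro finite_measure_mono) measurable
    also have "\<dots> \<le> (\<Sum>i\<in>UNIV. prob (?A i))"
      by (intro finite_measure_subadditive_finite) auto
    also have "\<dots> < (\<Sum>i\<in>(UNIV :: 'n set). p / CARD('n))"
      using elim by (intro sum_strict_mono) auto
    finally show ?case by simp
  qed
  then show thesis using that[of "\<Sum>i\<in>UNIV. M i"] M(1) by (simp add: sum_pos)
qed

end

section \<open>Oscillation of the noise in all directions at once\<close>

text \<open>Serves events that are not known to be measurable, such as a union over all directions: the event
  lies in the intersection of the late covers, which is null.\<close>

lemma AE_not_of_vanishing_cover:
  assumes "finite_measure M" and B: "\<And>n. B n \<in> sets M"
    and cover: "\<forall>\<^sub>F n in sequentially. {\<omega>\<in>space M. Q \<omega>} \<subseteq> B n"
    and lim: "(\<lambda>n. measure M (B n)) \<longlonglongrightarrow> 0"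
  shows "AE \<omega> in M. \<not> Q \<omega>"
proof -
  interpret finite_measure M by fact
  obtain n0 where n0: "\<And>n. n \<ge> n0 \<Longrightarrow> {\<omega>\<in>space M. Q \<omega>} \<subseteq> B n"
    using cover unfolding eventually_sequentially by blast
  let ?N = "\<Inter>n\<in>{n0..}. B n"
  have N: "?N \<in> sets M" using B by (intro sets.countable_INT) auto
  have "measure M ?N \<le> 0"
  proof (rule tendsto_lowerbound[OF lim])
    show "\<forall>\<^sub>F n in sequentially. measure M ?N \<le> measure M (B n)"
      using eventually_ge_at_top[of n0] by eventually_elim (auto intro!: finite_measure_mono B)
  qed simp
  then have "?N \<in> null_sets M"
    using N by (intro null_setsI) (simp_all add: emeasure_eq_measure measure_le_0_iff)
  moreover have "{\<omega>\<in>space M. \<not> \<not> Q \<omega>} \<subseteq> ?N" using n0 by auto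
  ultimately show ?thesis by (rule AE_I')
qed

lemma levy_increments_all_in:
  assumes levy: "levy_process P L b \<Sigma> \<nu>" and P: "prob_space P" and h: "0 \<le> h" and B: "B \<in> sets borel"
  shows "measure P {\<omega>\<in>space P. \<forall>k<Suc n. L (real (Suc k) * h) \<omega> - L (real k * h) \<omega> \<in> B} =
    measure P {\<omega>\<in>space P. L h \<omega> \<in> B} ^ Suc n"
proof -
  interpret prob_space P by (rule P)
  have [measurable]: "L s \<in> borel_measurable P" for s
    by (rule levy_process_measurable[OF levy])
  have [measurable]: "B \<in> sets borel" by (rule B)
  let ?X = "\<lambda>k \<omega>. L (real (Suc k) * h) \<omega> - L (real k * h) \<omega>"
  have "\<forall>(n::nat) \<tau> :: nat \<Rightarrow> real. (\<forall>k<n. \<tau> k \<le> \<tau> (Suc k)) \<longrightarrow>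
        indep_vars (\<lambda>_. borel) (\<lambda>k \<omega>. L (\<tau> (Suc k)) \<omega> - L (\<tau> k) \<omega>) {..<n}"
    using levy unfolding levy_process_def by blast
  from this[rule_format, of "Suc n" "\<lambda>k. real k * h"]
  have indep: "indep_vars (\<lambda>_. borel) ?X {..<Suc n}"
    using h by (simp add: mult_right_mono)
  have single: "prob (?X k -` B \<inter> space P) = prob {\<omega>\<in>space P. L h \<omega> \<in> B}" for k
  proof -
    have "distr P borel (?X k) = distr P borel (L (real (Suc k) * h - real k * h))"
    proof -
      have "\<forall>s t. s \<le> t \<longrightarrow> distr P borel (\<lambda>\<omega>. L t \<omega> - L s \<omega>) = distr P borel (L (t - s))"
        using levy unfolding levy_process_def by blast
      then show ?thesis using h by (simp only: mult_right_mono of_nat_mono le_SucI order_refl)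
    qed
    then have "distr P borel (?X k) = distr P borel (L h)"
      by (simp add: algebra_simps)
    then have "measure (distr P borel (?X k)) B = measure (distr P borel (L h)) B" by simp
    then show ?thesis
      by (simp add: measure_distr vimage_def Int_def conj_commute)
  qed
  have "{\<omega>\<in>space P. \<forall>k<Suc n. ?X k \<omega> \<in> B} = (\<Inter>k\<in>{..<Suc n}. ?X k -` B \<inter> space P)"
    by auto
  also have "prob \<dots> = (\<Prod>k<Suc n. prob (?X k -` B \<inter> space P))"
    by (rule indep_varsD_finite[OF indep]) auto
  finally show ?thesis unfolding single by simp
qed

text \<open>Call an increment \<open>\<Delta>\<close> over a step \<open>h\<close> flat for \<open>y\<close> if \<open>\<bar>y \<bullet> \<Delta>\<bar> \<le> \<eta> sqrt h\<close> or \<open>norm \<Delta> > M sqrt h\<close>. The constants are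
  chosen so that for small \<open>h\<close> each alternative has probability less than a quarter. If \<open>x\<close> is within
  \<open>\<eta> / (2 M)\<close> of \<open>y\<close> and \<open>x \<bullet> L\<close> is Lipschitz with constant \<open>C\<close>, then \<open>\<bar>y \<bullet> \<Delta>\<bar> \<le> C h + (\<eta> / (2 M)) norm \<Delta>\<close>, and
  every increment is flat for \<open>y\<close> as soon as \<open>C sqrt h \<le> \<eta> / 2\<close>. For each of the finitely many centres \<open>y\<close>
  this has probability at most \<open>2\<^sup>-\<^sup>n\<close> when there are \<open>n\<close> increments.

  Counting large increments as flat is what allows the centres to be chosen once, before \<open>n\<close>.\<close>

lemma levy_not_lipschitz_with_constant:
  fixes L :: "real \<Rightarrow> 'a \<Rightarrow> real^'n"
  assumes levy: "levy_process P L b \<Sigma> \<nu>" and P: "prob_space P" and cov: "sym_pos_def \<Sigma>"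
    and T: "0 < T" "T \<le> 1"
  shows "AE \<omega> in P. \<not> (\<exists>x. norm x = 1 \<and>
    (\<forall>r s. 0 \<le> r \<longrightarrow> r \<le> s \<longrightarrow> s \<le> T \<longrightarrow> \<bar>x \<bullet> (L s \<omega> - L r \<omega>)\<bar> \<le> C * (s - r)))"
proof -
  interpret prob_space P by (rule P)
  have [measurable]: "L s \<in> borel_measurable P" for s
    by (rule levy_process_measurable[OF levy])
  define h where "h = (\<lambda>n. T / real (Suc n))"
  have h: "\<And>n. 0 < h n" "\<And>n. h n \<le> 1" "h \<longlonglongrightarrow> 0"
  proof -
    show "0 < h n" for n using T by (simp add: h_def)
    show "h n \<le> 1" for n using T by (simp add: h_def divide_le_eq)
    show "h \<longlonglongrightarrow> 0"
      using tendsto_mult_left[OF LIMSEQ_inverse_real_of_nat, of T]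
      by (simp add: h_def divide_inverse)
  qed
  obtain M where M: "0 < M" and tight: "\<forall>\<^sub>F n in sequentially. prob {\<omega>\<in>space P. norm (L (h n) \<omega>) > M * sqrt (h n)} < 1/4"
    by (rule levy_small_time_tight[OF levy P cov h, of "1/4"]) auto
  have "\<forall>y. \<exists>\<eta>. y \<noteq> 0 \<longrightarrow> 0 < \<eta> \<and> (\<forall>\<^sub>F n in sequentially. prob {\<omega>\<in>space P. \<bar>y \<bullet> L (h n) \<omega>\<bar> \<le> \<eta> * sqrt (h n)} < 1/4)"
  proof
    fix y
    show "\<exists>\<eta>. y \<noteq> 0 \<longrightarrow> 0 < \<eta> \<and> (\<forall>\<^sub>F n in sequentially. prob {\<omega>\<in>space P. \<bar>y \<bullet> L (h n) \<omega>\<bar> \<le> \<eta> * sqrt (h n)} < 1/4)"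
    proof (cases "y = 0")
      case False
      show ?thesis
        by (rule levy_small_time_no_atom[OF levy P cov h False, of "1/4"]) (simp, intro exI impI conjI)
    qed simp
  qed
  from choice[OF this] obtain \<eta> where "\<forall>y. y \<noteq> 0 \<longrightarrow> 0 < \<eta> y \<and> (\<forall>\<^sub>F n in sequentially. prob {\<omega>\<in>space P. \<bar>y \<bullet> L (h n) \<omega>\<bar> \<le> \<eta> y * sqrt (h n)} < 1/4)" ..
  then have \<eta>: "\<And>y. y \<noteq> 0 \<Longrightarrow> 0 < \<eta> y"
    and flat: "\<And>y. y \<noteq> 0 \<Longrightarrow> \<forall>\<^sub>F n in sequentially. prob {\<omega>\<in>space P. \<bar>y \<bullet> L (h n) \<omega>\<bar> \<le> \<eta> y * sqrt (h n)} < 1/4"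
    by simp_all
  obtain D where D: "D \<subseteq> sphere 0 1" "finite D" "sphere 0 1 \<subseteq> (\<Union>y\<in>D. ball y (\<eta> y / (2 * M)))"
  proof (rule compactE_image[of "sphere (0 :: real^'n) 1" "sphere 0 1" "\<lambda>y. ball y (\<eta> y / (2 * M))"])
    have "y \<in> ball y (\<eta> y / (2 * M))" if "y \<in> sphere 0 1" for y
      using \<eta>[of y] M that by force
    then show "sphere 0 1 \<subseteq> (\<Union>y\<in>sphere 0 1. ball y (\<eta> y / (2 * M)))" by blast
  qed auto
  have D0: "y \<noteq> 0" if "y \<in> D" for y using D(1) that by force
  define S where "S = (\<lambda>y n. {v. \<bar>y \<bullet> v\<bar> \<le> \<eta> y * sqrt (h n) \<or> norm v > M * sqrt (h n)})"
  define G where "G = (\<lambda>y n. {\<omega>\<in>space P. \<forall>k<Suc n. L (real (Suc k) * h n) \<omega> - L (real k * h n) \<omega> \<in> S y n})"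
  have S [measurable]: "S y n \<in> sets borel" for y n
    unfolding S_def by measurable
  have G_sets [measurable]: "G y n \<in> sets P" for y n
    unfolding G_def by measurable
  have G_bound: "\<forall>\<^sub>F n in sequentially. prob (G y n) \<le> (1/2) ^ Suc n" if "y \<in> D" for y
    using flat[OF D0[OF that]] tight
  proof eventually_elim
    case (elim n)
    have "{\<omega>\<in>space P. L (h n) \<omega> \<in> S y n} =
      {\<omega>\<in>space P. \<bar>y \<bullet> L (h n) \<omega>\<bar> \<le> \<eta> y * sqrt (h n)} \<union> {\<omega>\<in>space P. norm (L (h n) \<omega>) > M * sqrt (h n)}"
      by (auto simp: S_def)
    also have "prob \<dots> \<le> prob {\<omega>\<in>space P. \<bar>y \<bullet> L (h n) \<omega>\<bar> \<le> \<eta> y * sqrt (h n)}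
        + prob {\<omega>\<in>space P. norm (L (h n) \<omega>) > M * sqrt (h n)}"
      by (rule measure_subadditive) (auto simp: fmeasurable_def)
    also have "\<dots> \<le> 1/2" using elim by simp
    finally have "prob {\<omega>\<in>space P. L (h n) \<omega> \<in> S y n} ^ Suc n \<le> (1/2) ^ Suc n"
      by (rule power_mono) simp
    then show ?case
      unfolding G_def using levy_increments_all_in[OF levy P less_imp_le[OF h(1)] S] by simp
  qed
  show ?thesis
  proof (rule AE_not_of_vanishing_cover[of _ "\<lambda>n. \<Union>y\<in>D. G y n"])
    show "finite_measure P" by unfold_locales
    show "(\<Union>y\<in>D. G y n) \<in> sets P" for n using D(2) by auto
    have upper: "(\<lambda>n. real (card D) * (1/2) ^ Suc n) \<longlonglongrightarrow> 0"
      by (intro tendsto_mult_right_zero LIMSEQ_Suc LIMSEQ_power_zero) simp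
    show "(\<lambda>n. prob (\<Union>y\<in>D. G y n)) \<longlonglongrightarrow> 0"
    proof (rule tendsto_sandwich[OF _ _ tendsto_const upper])
      have "\<forall>\<^sub>F n in sequentially. \<forall>y\<in>D. prob (G y n) \<le> (1/2) ^ Suc n"
        using D(2) G_bound by (simp add: eventually_ball_finite)
      then show "\<forall>\<^sub>F n in sequentially. prob (\<Union>y\<in>D. G y n) \<le> real (card D) * (1/2) ^ Suc n"
      proof eventually_elim
        case (elim n)
        have "prob (\<Union>y\<in>D. G y n) \<le> (\<Sum>y\<in>D. prob (G y n))"
          using D(2) by (intro finite_measure_subadditive_finite) auto
        also have "\<dots> \<le> real (card D) * (1/2) ^ Suc n"
          using elim by (intro sum_bounded_above) auto
        finally show ?case .
      qed
    qed simp
    have "(\<lambda>n. C * sqrt (h n)) \<longlonglongrightarrow> C * sqrt 0"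
      by (intro tendsto_mult tendsto_const tendsto_real_sqrt h)
    then have C_lim: "(\<lambda>n. C * sqrt (h n)) \<longlonglongrightarrow> 0" by simp
    have small: "\<forall>\<^sub>F n in sequentially. C * sqrt (h n) < \<eta> y / 2" if "y \<in> D" for y
    proof (rule order_tendstoD(2)[OF C_lim])
      show "0 < \<eta> y / 2" using \<eta>[OF D0[OF that]] by simp
    qed
    have "\<forall>\<^sub>F n in sequentially. \<forall>y\<in>D. C * sqrt (h n) < \<eta> y / 2"
      using D(2) small by (simp add: eventually_ball_finite)
    then show "\<forall>\<^sub>F n in sequentially. {\<omega>\<in>space P. \<exists>x. norm x = 1 \<and>
        (\<forall>r s. 0 \<le> r \<longrightarrow> r \<le> s \<longrightarrow> s \<le> T \<longrightarrow> \<bar>x \<bullet> (L s \<omega> - L r \<omega>)\<bar> \<le> C * (s - r))} \<subseteq> (\<Union>y\<in>D. G y n)"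
    proof eventually_elim
      case (elim n)
      show ?case
      proof (rule subsetI)
        fix \<omega> assume "\<omega> \<in> {\<omega>\<in>space P. \<exists>x. norm x = 1 \<and>
          (\<forall>r s. 0 \<le> r \<longrightarrow> r \<le> s \<longrightarrow> s \<le> T \<longrightarrow> \<bar>x \<bullet> (L s \<omega> - L r \<omega>)\<bar> \<le> C * (s - r))}"
        then obtain x where \<omega>: "\<omega> \<in> space P" and x: "norm x = 1"
          and lip: "\<And>r s. 0 \<le> r \<Longrightarrow> r \<le> s \<Longrightarrow> s \<le> T \<Longrightarrow> \<bar>x \<bullet> (L s \<omega> - L r \<omega>)\<bar> \<le> C * (s - r)"
          by blast
        have "x \<in> sphere 0 1" using x by simp
        then obtain y where y: "y \<in> D" and xy: "norm (y - x) < \<eta> y / (2 * M)"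
          using D(3) by (auto simp: dist_norm)
        have "L (real (Suc k) * h n) \<omega> - L (real k * h n) \<omega> \<in> S y n" if k: "k < Suc n" for k
        proof -
          let ?v = "L (real (Suc k) * h n) \<omega> - L (real k * h n) \<omega>"
          have "real (Suc k) * h n \<le> real (Suc n) * h n"
            using k h(1)[of n] by (intro mult_right_mono) auto
          also have "\<dots> = T" by (simp add: h_def)
          finally have "\<bar>x \<bullet> ?v\<bar> \<le> C * (real (Suc k) * h n - real k * h n)"
            using h(1)[of n] by (intro lip) (auto simp: mult_right_mono)
          also have "\<dots> = (C * sqrt (h n)) * sqrt (h n)"
            using h(1)[of n] by (simp add: algebra_simps)
          also have "\<dots> \<le> \<eta> y / 2 * sqrt (h n)"
            using elim y h(1)[of n] by (intro mult_right_mono) (auto simp: less_imp_le)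
          finally have 1: "\<bar>x \<bullet> ?v\<bar> \<le> \<eta> y / 2 * sqrt (h n)" .
          have "\<bar>y \<bullet> ?v\<bar> \<le> \<eta> y * sqrt (h n)" if "norm ?v \<le> M * sqrt (h n)"
          proof -
            have "\<bar>(y - x) \<bullet> ?v\<bar> \<le> norm (y - x) * norm ?v" by (rule Cauchy_Schwarz_ineq2)
            also have "\<dots> \<le> \<eta> y / (2 * M) * (M * sqrt (h n))"
              using less_imp_le[OF xy] that
              by (intro mult_mono order_trans[OF norm_ge_zero less_imp_le[OF xy]]) simp_all
            also have "\<dots> = \<eta> y / 2 * sqrt (h n)" using M by simp
            finally have "\<bar>y \<bullet> ?v - x \<bullet> ?v\<bar> \<le> \<eta> y / 2 * sqrt (h n)" by (simp only: inner_diff_left)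
            then show ?thesis using 1 by linarith
          qed
          then show ?thesis unfolding S_def by (auto simp: not_less)
        qed
        then have "\<omega> \<in> G y n" using \<omega> unfolding G_def by blast
        then show "\<omega> \<in> (\<Union>y\<in>D. G y n)" using y by blast
      qed
    qed
  qed
qed

text \<open>By scaling, unit vectors and natural Lipschitz constants suffice, and the latter form a countable
  family of null sets.\<close>

lemma levy_not_lipschitz_in_any_direction:
  fixes L :: "real \<Rightarrow> 'a \<Rightarrow> real^'n"
  assumes levy: "levy_process P L b \<Sigma> \<nu>" and P: "prob_space P" and cov: "sym_pos_def \<Sigma>" and T: "0 < T"
  shows "AE \<omega> in P. \<forall>x C. x \<noteq> 0 \<longrightarrow>
    \<not> (\<forall>r s. 0 \<le> r \<longrightarrow> r \<le> s \<longrightarrow> s \<le> T \<longrightarrow> \<bar>x \<bullet> (L s \<omega> - L r \<omega>)\<bar> \<le> C * (s - r))"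
proof -
  have "AE \<omega> in P. \<forall>m::nat. \<not> (\<exists>x. norm x = 1 \<and>
    (\<forall>r s. 0 \<le> r \<longrightarrow> r \<le> s \<longrightarrow> s \<le> min T 1 \<longrightarrow> \<bar>x \<bullet> (L s \<omega> - L r \<omega>)\<bar> \<le> real m * (s - r)))"
    unfolding AE_all_countable
    by (intro allI levy_not_lipschitz_with_constant[OF levy P cov]) (use T in auto)
  then show ?thesis
  proof (rule AE_mp, intro AE_I2 impI allI notI)
    fix \<omega> x C
    assume never: "\<forall>m::nat. \<not> (\<exists>x. norm x = 1 \<and>
        (\<forall>r s. 0 \<le> r \<longrightarrow> r \<le> s \<longrightarrow> s \<le> min T 1 \<longrightarrow> \<bar>x \<bullet> (L s \<omega> - L r \<omega>)\<bar> \<le> real m * (s - r)))"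
      and x: "x \<noteq> 0"
      and lip: "\<forall>r s. 0 \<le> r \<longrightarrow> r \<le> s \<longrightarrow> s \<le> T \<longrightarrow> \<bar>x \<bullet> (L s \<omega> - L r \<omega>)\<bar> \<le> C * (s - r)"
    obtain m :: nat where m: "C / norm x \<le> real m" using real_arch_simple by blast
    have "\<bar>sgn x \<bullet> (L s \<omega> - L r \<omega>)\<bar> \<le> real m * (s - r)" if "0 \<le> r" "r \<le> s" "s \<le> min T 1" for r s
    proof -
      have "\<bar>sgn x \<bullet> (L s \<omega> - L r \<omega>)\<bar> = \<bar>x \<bullet> (L s \<omega> - L r \<omega>)\<bar> / norm x"
        by (simp add: sgn_div_norm abs_mult divide_inverse)
      also have "\<dots> \<le> (C * (s - r)) / norm x"
        using lip that by (intro divide_right_mono) auto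
      also have "\<dots> = C / norm x * (s - r)" by simp
      also have "\<dots> \<le> real m * (s - r)"
        using m that by (intro mult_right_mono) auto
      finally show ?thesis .
    qed
    moreover have "norm (sgn x) = 1" using x by (simp add: norm_sgn)
    ultimately show False using never by blast
  qed
qed

section \<open>Paths of the process span the space\<close>

text \<open>If \<open>x \<bullet> Y\<^sub>s = 0\<close> up to time \<open>t\<close>, then the equation expresses the increments of \<open>x \<bullet> L\<close> through the drift
  integral alone, which is Lipschitz; almost surely only \<open>x = 0\<close>
  allows this. The interval is halved because the path is known to lie in the
  hyperplane only before \<open>t\<close>, while the noise is examined on a closed interval.\<close>

lemma ou_path_spans:
  fixes Y L :: "real \<Rightarrow> 'a \<Rightarrow> real^'n"
  assumes levy: "levy_process P L b \<Sigma> \<nu>" and P: "prob_space P" and cov: "sym_pos_def \<Sigma>"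
    and cadlag: "\<And>\<omega>. \<omega> \<in> space P \<Longrightarrow> cadlag_on {0..} (\<lambda>t. Y t \<omega>)"
    and meas: "\<And>\<omega> T. \<omega> \<in> space P \<Longrightarrow> (\<lambda>s. indicator {0..T} s *\<^sub>R Y s \<omega>) \<in> borel_measurable borel"
    and ou: "solves_ou P L Q Y" and t: "0 < t"
  shows "AE \<omega> in P. \<forall>x. (\<forall>s\<in>{0..<t}. x \<bullet> Y s \<omega> = 0) \<longrightarrow> x = 0"
proof -
  define T where "T = t / 2"
  have T: "0 < T" "T < t" using t by (simp_all add: T_def)
  have "AE \<omega> in P. \<forall>x C. x \<noteq> 0 \<longrightarrow>
    \<not> (\<forall>r s. 0 \<le> r \<longrightarrow> r \<le> s \<longrightarrow> s \<le> T \<longrightarrow> \<bar>x \<bullet> (L s \<omega> - L r \<omega>)\<bar> \<le> C * (s - r))"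
    by (rule levy_not_lipschitz_in_any_direction[OF levy P cov T(1)])
  moreover have "AE \<omega> in P. \<forall>t\<ge>0. Y t \<omega> =
      Y 0 \<omega> - (LINT s:{0..t}|lborel. Q *v Lim (at_left s) (\<lambda>r. Y r \<omega>)) + (L t \<omega> - L 0 \<omega>)"
    using ou unfolding solves_ou_def .
  ultimately show ?thesis using AE_space
  proof eventually_elim
    case (elim \<omega>)
    let ?J = "\<lambda>s. LINT u:{0..s}|lborel. Q *v Lim (at_left u) (\<lambda>r. Y r \<omega>)"
    obtain K where K: "set_integrable lborel {0..T} (\<lambda>s. Q *v Lim (at_left s) (\<lambda>r. Y r \<omega>))"
      "\<And>s. s \<in> {0..T} \<Longrightarrow> norm (Q *v Lim (at_left s) (\<lambda>r. Y r \<omega>)) \<le> K"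
      by (rule cadlag_left_limits_integrable[OF cadlag[OF elim(3)] meas[OF elim(3)], where Q = Q and T = T]) blast
    show ?case
    proof (intro allI impI, rule ccontr)
      fix x assume flat: "\<forall>s\<in>{0..<t}. x \<bullet> Y s \<omega> = 0" and x: "x \<noteq> 0"
      have eq: "x \<bullet> L s \<omega> = x \<bullet> ?J s + x \<bullet> L 0 \<omega>" if s: "0 \<le> s" "s \<le> T" for s
      proof -
        have "Y s \<omega> = Y 0 \<omega> - ?J s + (L s \<omega> - L 0 \<omega>)" using elim(2) s by blast
        then have "x \<bullet> Y s \<omega> = x \<bullet> (Y 0 \<omega> - ?J s + (L s \<omega> - L 0 \<omega>))" by (rule arg_cong)
        moreover have "x \<bullet> Y s \<omega> = 0" "x \<bullet> Y 0 \<omega> = 0" using flat s T by auto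
        ultimately show ?thesis unfolding inner_add_right inner_diff_right by linarith
      qed
      have "\<bar>x \<bullet> (L s \<omega> - L r \<omega>)\<bar> \<le> (norm x * K) * (s - r)" if rs: "0 \<le> r" "r \<le> s" "s \<le> T" for r s
      proof -
        have "x \<bullet> (L s \<omega> - L r \<omega>) = x \<bullet> (?J s - ?J r)"
          using eq[of s] eq[of r] rs unfolding inner_diff_right by linarith
        then have "\<bar>x \<bullet> (L s \<omega> - L r \<omega>)\<bar> \<le> norm x * norm (?J s - ?J r)"
          by (simp only: Cauchy_Schwarz_ineq2)
        also have "\<dots> \<le> norm x * (K * (s - r))"
          by (intro mult_left_mono norm_set_integral_increment_le[OF K rs]) simp_all
        finally show ?thesis by (simp only: mult.assoc)
      qed
      then show False using elim(1) x by blast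
    qed
  qed
qed

section \<open>The maximum likelihood estimator\<close>

theorem theorem3p4p4:
  fixes A \<Sigma> :: "real^'n^'n" and b :: "real^'n" and \<nu> :: "(real^'n) measure"
    and \<psi> :: "real^('n \<times> 'n)" and \<Psi> :: "(real^('n \<times> 'n)) set"
    and P P0 :: "'a measure" and F :: "real \<Rightarrow> 'a measure"
    and L Y Yc :: "real \<Rightarrow> 'a \<Rightarrow> real^'n"
    and I :: "real \<Rightarrow> 'a \<Rightarrow> real^('n \<times> 'n)"
  assumes graph: "adjacency_matrix A"
    and prob: "prob_space P" "prob_space P0" "space P0 = space P" "sets P0 = sets P"
    and filt: "filtration (space P) F" "\<And>t. subalgebra P (F t)"
    and levy: "levy_process P L b \<Sigma> \<nu>"
    and cov: "sym_pos_def \<Sigma>"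
    and log_moment: "(\<integral>\<^sup>+ z\<in>{z. norm z > 1}. ennreal (ln (norm z)) \<partial>\<nu>) < \<infinity>"
    and eigen: "\<And>z. complex_eigenvalue (grou_matrix A \<psi>) z \<Longrightarrow> Re z > 0"
    and Y_paths: "adapted F Y" "\<And>\<omega>. \<omega> \<in> space P \<Longrightarrow> cadlag_on {0..} (\<lambda>t. Y t \<omega>)"
    and Y_ou: "solves_ou P L (grou_matrix A \<psi>) Y"
    and Y0_indep: "prob_space.indep_set P
           (sets (vimage_algebra (space P) (Y 0) borel))
           (sets (vimage_algebra (space P) (\<lambda>\<omega>. \<lambda>t\<in>{0..}. L t \<omega>) (Pi\<^sub>M {0..} (\<lambda>_. borel))))"
    and Y_stationary: "strictly_stationary P Y"
    and Y_moments: "\<And>t. t \<ge> 0 \<Longrightarrow> integrable P (\<lambda>\<omega>. (norm (Y t \<omega>))\<^sup>2)"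
    and Yc: "\<And>i. continuous_martingale_part P0 (usual_augmentation P0 F)
           (\<lambda>t \<omega>. Y t \<omega> $ i) (\<lambda>t \<omega>. Yc t \<omega> $ i)"
    and dens: "\<And>t. t \<ge> 0 \<Longrightarrow> ou_density_at P P0 F \<Sigma> (grou_matrix A \<psi>) Y Yc t"
    and score: "\<And>t. t \<ge> 0 \<Longrightarrow> is_score_integral P0 F \<Sigma> Y Yc t (I t)"
    and params: "compact \<Psi>" "\<Psi> \<subseteq> dominant_params A"
  shows "(\<forall>t\<ge>0. \<forall>\<omega>\<in>space P. \<forall>\<phi>.
            is_mle (I t \<omega>) (I_bracket \<Sigma> Y t \<omega>) \<phi> \<or>
            is_mle_on \<Psi> (I t \<omega>) (I_bracket \<Sigma> Y t \<omega>) \<phi> \<and> \<phi> \<in> interior \<Psi> \<longrightarrow>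
            I t \<omega> = I_bracket \<Sigma> Y t \<omega> *v \<phi>) \<and>
         (\<exists>t0\<ge>0. \<forall>t\<ge>t0. AE \<omega> in restr_to_subalg P (F t).
            det (I_bracket \<Sigma> Y t \<omega>) > 0 \<and>
            (\<forall>\<phi>. is_mle (I t \<omega>) (I_bracket \<Sigma> Y t \<omega>) \<phi> \<longleftrightarrow>
                 \<phi> = matrix_inv (I_bracket \<Sigma> Y t \<omega>) *v I t \<omega>) \<and>
            (\<forall>\<phi>\<in>interior \<Psi>. is_mle_on \<Psi> (I t \<omega>) (I_bracket \<Sigma> Y t \<omega>) \<phi> \<longrightarrow>
                 \<phi> = matrix_inv (I_bracket \<Sigma> Y t \<omega>) *v I t \<omega>)) \<and>
         (\<forall>t>0. AE \<omega> in restr_to_subalg P (F t).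
            (\<exists>!\<phi>. is_mle (I t \<omega>) (I_bracket \<Sigma> Y t \<omega>) \<phi>) \<and>
            (\<forall>\<phi>\<in>\<Psi>. is_mle (I t \<omega>) (I_bracket \<Sigma> Y t \<omega>) \<phi> \<longrightarrow>
               (\<exists>!\<phi>'. is_mle_on \<Psi> (I t \<omega>) (I_bracket \<Sigma> Y t \<omega>) \<phi>')))"
proof -
  let ?B = "I_bracket \<Sigma> Y"
  have prog: "(\<lambda>(\<omega>, s). indicator {0..t} s *\<^sub>R Y s \<omega>) \<in> borel_measurable (F t \<Otimes>\<^sub>M borel)" for t
    using Y_paths filt(1) by (intro cadlag_adapted_imp_progressive)
  have spaceF: "space (F t) = space P" for t
    using filt(2) by (simp add: subalgebra_def)
  have path_meas: "(\<lambda>s. indicator {0..t} s *\<^sub>R Y s \<omega>) \<in> borel_measurable borel" if "\<omega> \<in> space P" for \<omega> t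
  proof -
    have "(\<lambda>s. (\<omega>, s)) \<in> borel \<rightarrow>\<^sub>M F t \<Otimes>\<^sub>M borel"
      using that spaceF by (intro measurable_Pair1') simp
    from measurable_compose[OF this prog] show ?thesis by simp
  qed
  have int: "set_integrable lborel {0..t} (\<lambda>s. Y s \<omega> $ i * Y s \<omega> $ j)" if \<omega>: "\<omega> \<in> space P" for \<omega> t i j
  proof -
    obtain K where K: "0 \<le> K" "\<And>s. s \<in> {0..t} \<Longrightarrow> norm (Y s \<omega>) \<le> K"
      using cadlag_on_bounded[OF Y_paths(2)[OF \<omega>]] by blast
    have "(\<lambda>s. (indicator {0..t} s *\<^sub>R Y s \<omega>) $ i * (indicator {0..t} s *\<^sub>R Y s \<omega>) $ j) \<in> borel_measurable borel"
      by (intro borel_measurable_times measurable_compose[OF path_meas[OF \<omega>]] borel_measurable_vec_nth)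
    also have "(\<lambda>s. (indicator {0..t} s *\<^sub>R Y s \<omega>) $ i * (indicator {0..t} s *\<^sub>R Y s \<omega>) $ j) =
        (\<lambda>s. indicator {0..t} s *\<^sub>R (Y s \<omega> $ i * Y s \<omega> $ j))"
      by (auto simp: fun_eq_iff indicator_def)
    finally show ?thesis
    proof (rule set_integrable_of_bounded)
      fix s assume s: "s \<in> {0..t}"
      have "\<bar>Y s \<omega> $ k\<bar> \<le> K" for k
        using component_le_norm_cart[of "Y s \<omega>" k] K(2)[OF s] by linarith
      then show "norm (Y s \<omega> $ i * Y s \<omega> $ j) \<le> K * K"
        using K(1) by (simp add: abs_mult mult_mono)
    qed
  qed
  have AE_det: "AE \<omega> in restr_to_subalg P (F t). det (?B t \<omega>) > 0" if t: "0 < t" for t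
  proof (rule AE_restr_to_subalg2[OF filt(2)])
    show "Measurable.pred (F t) (\<lambda>\<omega>. det (?B t \<omega>) > 0)"
      using measurable_det_I_bracket[OF prog, where \<Sigma> = \<Sigma> and t = t] by measurable
    have "AE \<omega> in P. \<forall>x. (\<forall>s\<in>{0..<t}. x \<bullet> Y s \<omega> = 0) \<longrightarrow> x = 0"
      by (rule ou_path_spans[OF levy prob(1) cov Y_paths(2) path_meas Y_ou t])
    then show "AE \<omega> in P. det (?B t \<omega>) > 0"
      using AE_space
    proof eventually_elim
      case (elim \<omega>)
      have "v \<bullet> (?B t \<omega> *v v) > 0" if v: "v \<noteq> 0" for v
      proof (rule ccontr)
        assume "\<not> v \<bullet> (?B t \<omega> *v v) > 0"
        then have "v \<bullet> (?B t \<omega> *v v) \<le> 0" by simp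
        from I_bracket_degenerate_imp_hyperplane[where Y = Y and \<omega> = \<omega>, OF int[OF elim(2)] cov
            cadlag_on_right_limit[OF Y_paths(2)[OF elim(2)]] v this]
        obtain x where "x \<noteq> 0" "\<And>s. s \<in> {0..<t} \<Longrightarrow> x \<bullet> Y s \<omega> = 0" by blast
        then show False using elim(1) by blast
      qed
      then show ?case by (rule pos_def_imp_det_pos)
    qed
  qed
  have AE_spd: "AE \<omega> in restr_to_subalg P (F t). sym_pos_def (?B t \<omega>)" if t: "0 < t" for t
    using AE_det[OF t] AE_space
  proof eventually_elim
    case (elim \<omega>)
    then have "\<omega> \<in> space P" by (simp add: space_restr_to_subalg)
    from I_bracket_sym_pos_def_iff_det_pos[where Y = Y and \<omega> = \<omega>, OF int[OF this] cov] elim(1)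
    show ?case by blast
  qed
  have score_eq: "I t \<omega> = ?B t \<omega> *v \<phi>"
    if "is_mle (I t \<omega>) (?B t \<omega>) \<phi> \<or> is_mle_on \<Psi> (I t \<omega>) (?B t \<omega>) \<phi> \<and> \<phi> \<in> interior \<Psi>" for t \<omega> \<phi>
    using that interior_mle_solves_score_equation[OF transpose_I_bracket[OF cov], of _ "I t \<omega>" Y t \<omega> \<phi>]
    by fastforce
  show ?thesis
  \<comment> \<open>Any positive time would do for \<open>t0\<close>.\<close>
  proof (intro conjI exI[of _ "1::real"] allI impI ballI)
    show "(0::real) \<le> 1" by simp
    show "I t \<omega> = ?B t \<omega> *v \<phi>"
      if "is_mle (I t \<omega>) (?B t \<omega>) \<phi> \<or> is_mle_on \<Psi> (I t \<omega>) (?B t \<omega>) \<phi> \<and> \<phi> \<in> interior \<Psi>" for t \<omega> \<phi>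
      using score_eq that .
    show "AE \<omega> in restr_to_subalg P (F t).
            det (?B t \<omega>) > 0 \<and>
            (\<forall>\<phi>. is_mle (I t \<omega>) (?B t \<omega>) \<phi> \<longleftrightarrow> \<phi> = matrix_inv (?B t \<omega>) *v I t \<omega>) \<and>
            (\<forall>\<phi>\<in>interior \<Psi>. is_mle_on \<Psi> (I t \<omega>) (?B t \<omega>) \<phi> \<longrightarrow>
                 \<phi> = matrix_inv (?B t \<omega>) *v I t \<omega>)" if "1 \<le> t" for t
    proof -
      have "0 < t" using that by simp
      from AE_det[OF this] AE_spd[OF this] show ?thesis
      proof eventually_elim
        case (elim \<omega>)
        have "\<phi> = matrix_inv (?B t \<omega>) *v I t \<omega>"
          if "is_mle_on \<Psi> (I t \<omega>) (?B t \<omega>) \<phi>" "\<phi> \<in> interior \<Psi>" for \<phi>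
        proof -
          have "invertible (?B t \<omega>)" using elim(1) by (simp add: invertible_det_nz)
          from matrix_inv_mult(2)[OF this] score_eq[of t \<omega> \<phi>] that show ?thesis
            by (simp add: matrix_vector_mul_assoc)
        qed
        then show ?case using elim(1) mle_iff_of_sym_pos_def[OF elim(2)] by blast
      qed
    qed
    show "AE \<omega> in restr_to_subalg P (F t).
            (\<exists>!\<phi>. is_mle (I t \<omega>) (?B t \<omega>) \<phi>) \<and>
            (\<forall>\<phi>\<in>\<Psi>. is_mle (I t \<omega>) (?B t \<omega>) \<phi> \<longrightarrow>
               (\<exists>!\<phi>'. is_mle_on \<Psi> (I t \<omega>) (?B t \<omega>) \<phi>'))" if "0 < t" for t
      using AE_spd[OF that]
    proof eventually_elim
      case (elim \<omega>)
      have unique: "\<exists>!\<phi>. is_mle (I t \<omega>) (?B t \<omega>) \<phi>"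
        using mle_iff_of_sym_pos_def[OF elim] by simp
      have "\<exists>!\<phi>'. is_mle_on \<Psi> (I t \<omega>) (?B t \<omega>) \<phi>'" if \<phi>: "\<phi> \<in> \<Psi>" "is_mle (I t \<omega>) (?B t \<omega>) \<phi>" for \<phi>
      \<comment> \<open>A maximiser on \<open>\<Psi>\<close> attains the global maximum, which \<open>\<phi>\<close> attains, so global uniqueness applies.\<close>
      proof (rule ex1I[of _ \<phi>])
        show "is_mle_on \<Psi> (I t \<omega>) (?B t \<omega>) \<phi>"
          using \<phi> by (auto simp: is_mle_on_def)
        fix \<phi>' assume "is_mle_on \<Psi> (I t \<omega>) (?B t \<omega>) \<phi>'"
        then have "is_mle (I t \<omega>) (?B t \<omega>) \<phi>'"
          using \<phi> unfolding is_mle_on_def by (metis UNIV_I order_trans)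
        then show "\<phi>' = \<phi>" using unique \<phi>(2) by blast
      qed
      then show ?case using unique by blast
    qed
  qed
qed

end
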